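(* Let $G$ be a second countable Moore group with compact identity component $G_0$. If $G$ satisfies weak QUP for Gabor transform, then $G/G_0$ is abelian.
   Context: A locally compact group $G$ is a Moore group if every irreducible unitary representation of $G$ is finite dimensional (such groups are unimodular and type I). $G_0$ denotes the connected component of the identity. Let $m$ be a Haar measure on $G$, $\widehat G$ the unitary dual, and $\mu$ the Plancherel measure corresponding to $m$, i.e. $\int_G|f|^2\,dm=\int_{\widehat G}\|\widehat f(\pi)\|_{HS}^2\,d\mu(\pi)$ for $f\in L^1(G)\cap L^2(G)$, where $\widehat f(\pi)=\int_G f(y)\pi(y)^*\,dm(y)$. A window function is a nonzero $\psi\in L^2(G)$. For $f,\psi\in L^2(G)$, $G_\psi f(x,\pi)=\int_G f(y)\overline{\psi(x^{-1}y)}\,\pi(y)^*\,dm(y)$, $(x,\pi)\in G\times\widehat G$ (weak sense integral). $G$ has weak QUP for Gabor transform if whenever $f\in L^2(G)$ and $\psi$ is a window function with $(m\times\mu)\{(x,\pi): G_\psi f(x,\pi)\neq 0\}<1$, then $f=0$ a.e. *)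

theory Defs
  imports "HOL-Analysis.Analysis" "HOL-Algebra.Coset"
begin

section \<open>The complex Hilbert space of square-summable sequences\<close>

typedef ell2 = "{v :: nat \<Rightarrow> complex. summable (\<lambda>i. (cmod (v i))\<^sup>2)}"
  morphisms coord Abs_ell2
  by (rule exI[of _ "\<lambda>_. 0"]) simp

lemma summable_coord: "summable (\<lambda>i. (cmod (coord v i))\<^sup>2)"
  using coord[of v] by simp

lemma ell2_eqI: "(\<And>i. coord u i = coord v i) \<Longrightarrow> u = v"
  by (simp add: coord_inject[symmetric] fun_eq_iff)

lemma summable_cmod_mult:
  assumes "summable (\<lambda>i. (cmod (a i))\<^sup>2)" "summable (\<lambda>i. (cmod (b i))\<^sup>2)"
  shows "summable (\<lambda>i. cmod (a i) * cmod (b i))"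
proof (rule summable_comparison_test')
  show "summable (\<lambda>i. (cmod (a i))\<^sup>2 + (cmod (b i))\<^sup>2)"
    using assms by (rule summable_add)
  fix i :: nat
  have "2 * cmod (a i) * cmod (b i) \<le> (cmod (a i))\<^sup>2 + (cmod (b i))\<^sup>2"
    by (rule sum_squares_bound)
  moreover have "0 \<le> cmod (a i) * cmod (b i)"
    by simp
  ultimately show "norm (cmod (a i) * cmod (b i)) \<le> (cmod (a i))\<^sup>2 + (cmod (b i))\<^sup>2"
    unfolding real_norm_def by linarith
qed

lemma summable_cmod_add_square:
  assumes "summable (\<lambda>i. (cmod (a i))\<^sup>2)" "summable (\<lambda>i. (cmod (b i))\<^sup>2)"
  shows "summable (\<lambda>i. (cmod (a i + b i))\<^sup>2)"
proof (rule summable_comparison_test')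
  show "summable (\<lambda>i. (cmod (a i))\<^sup>2 + (cmod (b i))\<^sup>2 + 2 * (cmod (a i) * cmod (b i)))"
    using assms by (intro summable_add summable_mult summable_cmod_mult)
  fix i :: nat
  have "(cmod (a i + b i))\<^sup>2 \<le> (cmod (a i) + cmod (b i))\<^sup>2"
    by (rule power_mono[OF norm_triangle_ineq]) simp
  then show "norm ((cmod (a i + b i))\<^sup>2)
      \<le> (cmod (a i))\<^sup>2 + (cmod (b i))\<^sup>2 + 2 * (cmod (a i) * cmod (b i))"
    by (simp add: power2_sum)
qed

lemma summable_coord_mult_cnj: "summable (\<lambda>i. coord u i * cnj (coord v i))"
  by (rule summable_norm_cancel)
    (simp add: norm_mult summable_cmod_mult summable_coord)

definition cscale :: "complex \<Rightarrow> ell2 \<Rightarrow> ell2"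
  where "cscale c v = Abs_ell2 (\<lambda>i. c * coord v i)"

definition cinner :: "ell2 \<Rightarrow> ell2 \<Rightarrow> complex"
  where "cinner u v = (\<Sum>i. coord u i * cnj (coord v i))"

lemma coord_cscale [simp]: "coord (cscale c v) i = c * coord v i"
  unfolding cscale_def
  by (subst Abs_ell2_inverse)
    (auto simp: norm_mult power_mult_distrib intro!: summable_mult summable_coord)

instantiation ell2 :: real_inner
begin

definition zero_ell2 :: ell2 where "0 = Abs_ell2 (\<lambda>_. 0)"
definition plus_ell2 :: "ell2 \<Rightarrow> ell2 \<Rightarrow> ell2"
  where "u + v = Abs_ell2 (\<lambda>i. coord u i + coord v i)"
definition uminus_ell2 :: "ell2 \<Rightarrow> ell2" where "- v = cscale (- 1) v"
definition minus_ell2 :: "ell2 \<Rightarrow> ell2 \<Rightarrow> ell2" where "u - v = u + (- v)" for u v :: ell2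
definition scaleR_ell2 :: "real \<Rightarrow> ell2 \<Rightarrow> ell2" where "r *\<^sub>R v = cscale (of_real r) v"
definition inner_ell2 :: "ell2 \<Rightarrow> ell2 \<Rightarrow> real" where "inner u v = Re (cinner u v)"
definition norm_ell2 :: "ell2 \<Rightarrow> real" where "norm v = sqrt (inner v v)" for v :: ell2
definition sgn_ell2 :: "ell2 \<Rightarrow> ell2" where "sgn v = inverse (norm v) *\<^sub>R v" for v :: ell2
definition dist_ell2 :: "ell2 \<Rightarrow> ell2 \<Rightarrow> real" where "dist u v = norm (u - v)" for u v :: ell2
definition uniformity_ell2 :: "(ell2 \<times> ell2) filter"
  where "uniformity_ell2 = (INF e\<in>{0<..}. principal {(x, y). dist x y < e})"
definition open_ell2 :: "ell2 set \<Rightarrow> bool"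
  where "open_ell2 U = (\<forall>x\<in>U. \<forall>\<^sub>F (x', y) in uniformity. x' = x \<longrightarrow> y \<in> U)"

lemma coord_zero: "coord 0 i = 0"
  unfolding zero_ell2_def by (subst Abs_ell2_inverse) auto

lemma coord_add: "coord (u + v) i = coord u i + coord v i"
  unfolding plus_ell2_def
  by (subst Abs_ell2_inverse) (auto intro!: summable_cmod_add_square summable_coord)

lemma coord_uminus: "coord (- v) i = - coord v i"
  by (simp add: uminus_ell2_def)

lemma coord_minus: "coord (u - v) i = coord u i - coord v i"
  by (simp add: minus_ell2_def coord_add coord_uminus)

lemma coord_scaleR: "coord (r *\<^sub>R v) i = of_real r * coord v i"
  by (simp add: scaleR_ell2_def)

lemma cinner_add_left_ell2: "cinner (u + v) w = cinner u w + cinner v w"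
  unfolding cinner_def coord_add distrib_right
  by (rule suminf_add[symmetric]) (rule summable_coord_mult_cnj)+

lemma cinner_cscale_left_ell2: "cinner (cscale c u) w = c * cinner u w"
  unfolding cinner_def coord_cscale mult.assoc
  by (rule suminf_mult) (rule summable_coord_mult_cnj)

lemma inner_ell2_sums: "(\<lambda>i. Re (coord u i * cnj (coord v i))) sums inner u v"
  unfolding inner_ell2_def cinner_def
  by (intro sums_Re summable_sums summable_coord_mult_cnj)

instance
proof
  fix u v w :: ell2 and a b :: real
  show "u + v + w = u + (v + w)" "u + v = v + u" "0 + u = u" "- u + u = 0" "u - v = u + - v"
    by (rule ell2_eqI, simp add: coord_zero coord_add coord_minus coord_uminus)+
  show "a *\<^sub>R (u + v) = a *\<^sub>R u + a *\<^sub>R v" "(a + b) *\<^sub>R u = a *\<^sub>R u + b *\<^sub>R u"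
    "a *\<^sub>R b *\<^sub>R u = (a * b) *\<^sub>R u" "1 *\<^sub>R u = u"
    by (rule ell2_eqI, simp add: coord_add coord_scaleR algebra_simps)+
  show "dist u v = norm (u - v)" by (rule dist_ell2_def)
  show "sgn u = inverse (norm u) *\<^sub>R u" by (rule sgn_ell2_def)
  show "uniformity = (INF e\<in>{0<..}. principal {(x :: ell2, y). dist x y < e})"
    by (rule uniformity_ell2_def)
  show "norm u = sqrt (inner u u)" by (rule norm_ell2_def)
  have "(\<lambda>i. Re (coord v i * cnj (coord u i))) = (\<lambda>i. Re (coord u i * cnj (coord v i)))"
    by (simp add: mult.commute)
  then show "inner u v = inner v u"
    using inner_ell2_sums[of u v] inner_ell2_sums[of v u] by (metis sums_unique2)
  show "inner (u + v) w = inner u w + inner v w"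
    by (simp add: inner_ell2_def cinner_add_left_ell2)
  show "inner (a *\<^sub>R u) v = a * inner u v"
    by (simp add: inner_ell2_def scaleR_ell2_def cinner_cscale_left_ell2)
  have sq: "Re (coord u i * cnj (coord u i)) = (cmod (coord u i))\<^sup>2" for i
    by (simp add: cmod_power2) (simp add: power2_eq_square)
  have su: "(\<lambda>i. (cmod (coord u i))\<^sup>2) sums inner u u"
    using inner_ell2_sums[of u u] unfolding sq .
  then show "0 \<le> inner u u"
    by (rule sums_le[OF _ sums_zero, rotated]) simp
  show "inner u u = 0 \<longleftrightarrow> u = 0"
  proof
    assume "inner u u = 0"
    then have "(\<Sum>i. (cmod (coord u i))\<^sup>2) = 0"
      using su by (simp add: sums_unique[symmetric])
    then have "\<forall>i. (cmod (coord u i))\<^sup>2 = 0"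
      using suminf_eq_zero_iff[OF summable_coord[of u]] by simp
    then show "u = 0" by (intro ell2_eqI) (simp add: coord_zero)
  next
    assume "u = 0"
    then show "inner u u = 0" using su sums_unique2[OF sums_zero] by (simp add: coord_zero)
  qed
next
  fix U :: "ell2 set"
  show "open U = (\<forall>x\<in>U. \<forall>\<^sub>F (x', y) in uniformity. x' = x \<longrightarrow> y \<in> U)"
    by (rule open_ell2_def)
qed

end

interpretation cvec: vector_space cscale
  by unfold_locales
    (rule ell2_eqI, simp add: coord_add algebra_simps)+


section \<open>Unitary representations\<close>

text \<open>
  Every separable complex Hilbert space is unitarily isomorphic to a closed subspace of
  \<^typ>\<open>ell2\<close>, and an irreducible unitary representation of a second countable group
  acts on a separable space, since it has a cyclic vector with a separable orbit.  Hence closed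
  subspaces of \<^typ>\<open>ell2\<close> suffice as representation spaces. Operators on a subspace
  \<open>H\<close> are total functions whose values outside \<open>H\<close> are irrelevant.
\<close>

definition closed_csubspace :: "ell2 set \<Rightarrow> bool"
  where "closed_csubspace H \<longleftrightarrow> cvec.subspace H \<and> closed H"

definition unitary_between :: "ell2 set \<Rightarrow> ell2 set \<Rightarrow> (ell2 \<Rightarrow> ell2) \<Rightarrow> bool" where
  "unitary_between H K U \<longleftrightarrow>
     bij_betw U H K \<and>
     (\<forall>u\<in>H. \<forall>v\<in>H. U (u + v) = U u + U v) \<and>
     (\<forall>c. \<forall>u\<in>H. U (cscale c u) = cscale c (U u)) \<and>
     (\<forall>u\<in>H. \<forall>v\<in>H. cinner (U u) (U v) = cinner u v)"

text \<open>Topological groups are written additively, although they need not be commutative.\<close>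

type_synonym 'g rep = "ell2 set \<times> ('g \<Rightarrow> ell2 \<Rightarrow> ell2)"

definition unitary_rep :: "'g::topological_group_add rep \<Rightarrow> bool" where
  "unitary_rep = (\<lambda>(H, \<pi>).
     closed_csubspace H \<and>
     (\<forall>x. unitary_between H H (\<pi> x)) \<and>
     (\<forall>x y. \<forall>v\<in>H. \<pi> (x + y) v = \<pi> x (\<pi> y v)) \<and>
     (\<forall>v\<in>H. continuous_on UNIV (\<lambda>x. \<pi> x v)))"

definition irreducible_rep :: "'g::topological_group_add rep \<Rightarrow> bool" where
  "irreducible_rep = (\<lambda>(H, \<pi>).
     unitary_rep (H, \<pi>) \<and> H \<noteq> {0} \<and>
     (\<forall>K. closed_csubspace K \<and> K \<subseteq> H \<and> (\<forall>x. \<pi> x ` K \<subseteq> K) \<longrightarrow> K = {0} \<or> K = H))"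

definition finite_dim :: "ell2 set \<Rightarrow> bool"
  where "finite_dim H \<longleftrightarrow> (\<exists>B. finite B \<and> H = cvec.span B)"

definition moore_group :: "'g::{topological_group_add, t2_space, second_countable_topology} itself \<Rightarrow> bool" where
  "moore_group _ \<longleftrightarrow>
     locally_compact_space (euclidean :: 'g topology) \<and>
     (\<forall>H (\<pi> :: 'g \<Rightarrow> ell2 \<Rightarrow> ell2). irreducible_rep (H, \<pi>) \<longrightarrow> finite_dim H)"


section \<open>The unitary dual and its Mackey Borel structure\<close>

definition rep_equiv :: "('g::topological_group_add rep \<times> 'g rep) set" where
  "rep_equiv = {((H, \<pi>), (K, \<rho>)).
     irreducible_rep (H, \<pi>) \<and> irreducible_rep (K, \<rho>) \<and>
     (\<exists>U. unitary_between H K U \<and> (\<forall>x. \<forall>v\<in>H. U (\<pi> x v) = \<rho> x (U v)))}"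

definition unitary_dual :: "'g::topological_group_add rep set set"
  where "unitary_dual = Collect irreducible_rep // rep_equiv"

definition class_rep :: "'g rep set \<Rightarrow> 'g rep"
  where "class_rep c = (SOME p. p \<in> c)"

definition irr_on :: "ell2 set \<Rightarrow> ('g::topological_group_add \<Rightarrow> ell2 \<Rightarrow> ell2) set"
  where "irr_on H = {\<pi>. irreducible_rep (H, \<pi>)}"

definition irr_borel :: "ell2 set \<Rightarrow> ('g::topological_group_add \<Rightarrow> ell2 \<Rightarrow> ell2) measure" where
  "irr_borel H = sigma (irr_on H)
     {{\<pi> \<in> irr_on H. cinner (\<pi> x u) v \<in> B} | x u v B. u \<in> H \<and> v \<in> H \<and> B \<in> sets borel}"

text \<open>
  Mackey's quotient structure. It is usually described with one fixed Hilbert space in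
  each dimension; unitary isomorphisms between the spaces \<open>H\<close> of equal dimension transport
  \<^term>\<open>irr_borel H\<close>, so that letting \<open>H\<close> range over all spaces is the same.
\<close>

definition dual_borel :: "'g::topological_group_add rep set measure" where
  "dual_borel = sigma unitary_dual
     {E. E \<subseteq> unitary_dual \<and>
         (\<forall>H. {\<pi> \<in> irr_on H. rep_equiv `` {(H, \<pi>)} \<in> E} \<in> sets (irr_borel H))}"


section \<open>Haar measure, Fourier transform, Plancherel measure\<close>

text \<open>Regularity is automatic: a locally finite Borel measure on a second countable locally compact
  Hausdorff space is Radon.\<close>

definition haar_measure ::
    "'g::{topological_group_add, t2_space, second_countable_topology} measure \<Rightarrow> bool" where
  "haar_measure m \<longleftrightarrow>
     sets m = sets borel \<and>
     emeasure m UNIV \<noteq> 0 \<and>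
     (\<forall>K. compact K \<longrightarrow> emeasure m K < \<infinity>) \<and>
     (\<forall>x. \<forall>A\<in>sets borel. emeasure m ((+) x ` A) = emeasure m A)"

definition L1 :: "'g measure \<Rightarrow> ('g \<Rightarrow> complex) set"
  where "L1 m = {f. integrable m f}"

definition L2 :: "'g measure \<Rightarrow> ('g \<Rightarrow> complex) set"
  where "L2 m = {f \<in> borel_measurable m. integrable m (\<lambda>x. (cmod (f x))\<^sup>2)}"

definition adjoint_on :: "ell2 set \<Rightarrow> (ell2 \<Rightarrow> ell2) \<Rightarrow> ell2 \<Rightarrow> ell2" where
  "adjoint_on H T = (SOME S. \<forall>u\<in>H. S u \<in> H \<and> (\<forall>v\<in>H. cinner (S u) v = cinner u (T v)))"

definition weak_integral :: "'g measure \<Rightarrow> ell2 set \<Rightarrow> ('g \<Rightarrow> ell2 \<Rightarrow> ell2) \<Rightarrow> ell2 \<Rightarrow> ell2" where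
  "weak_integral m H F =
     (SOME T. \<forall>u\<in>H. T u \<in> H \<and> (\<forall>v\<in>H. cinner (T u) v = (LINT y|m. cinner (F y u) v)))"

definition fourier :: "'g measure \<Rightarrow> ('g \<Rightarrow> complex) \<Rightarrow> 'g rep \<Rightarrow> ell2 \<Rightarrow> ell2" where
  "fourier m f = (\<lambda>(H, \<pi>). weak_integral m H (\<lambda>y u. cscale (f y) (adjoint_on H (\<pi> y) u)))"

definition orthonormal_basis :: "ell2 set \<Rightarrow> ell2 set \<Rightarrow> bool" where
  "orthonormal_basis H B \<longleftrightarrow>
     B \<subseteq> H \<and>
     (\<forall>e\<in>B. \<forall>e'\<in>B. cinner e e' = (if e = e' then 1 else 0)) \<and>
     closure (cvec.span B) = H"

definition hs_norm_sq :: "ell2 set \<Rightarrow> (ell2 \<Rightarrow> ell2) \<Rightarrow> ennreal" where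
  "hs_norm_sq H T =
     (\<Sum>\<^sub>\<infinity>e \<in> (SOME B. orthonormal_basis H B). ennreal ((norm (T e))\<^sup>2))"

definition plancherel_measure ::
    "'g::topological_group_add measure \<Rightarrow> 'g rep set measure \<Rightarrow> bool" where
  "plancherel_measure m \<mu> \<longleftrightarrow>
     sets \<mu> = sets dual_borel \<and>
     (\<forall>f \<in> L1 m \<inter> L2 m.
        (\<integral>\<^sup>+x. ennreal ((cmod (f x))\<^sup>2) \<partial>m) =
        (\<integral>\<^sup>+c. hs_norm_sq (fst (class_rep c)) (fourier m f (class_rep c)) \<partial>\<mu>))"


section \<open>The Gabor transform and the weak qualitative uncertainty principle\<close>

definition window :: "'g measure \<Rightarrow> ('g \<Rightarrow> complex) \<Rightarrow> bool"
  where "window m \<psi> \<longleftrightarrow> \<psi> \<in> L2 m \<and> \<not> (AE x in m. \<psi> x = 0)"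

definition gabor ::
    "'g::topological_group_add measure \<Rightarrow> ('g \<Rightarrow> complex) \<Rightarrow> ('g \<Rightarrow> complex) \<Rightarrow> 'g \<Rightarrow> 'g rep \<Rightarrow> ell2 \<Rightarrow> ell2"
  where "gabor m \<psi> f x = (\<lambda>(H, \<pi>). weak_integral m H
     (\<lambda>y u. cscale (f y * cnj (\<psi> (- x + y))) (adjoint_on H (\<pi> y) u)))"

definition gabor_support ::
    "'g::topological_group_add measure \<Rightarrow> ('g \<Rightarrow> complex) \<Rightarrow> ('g \<Rightarrow> complex) \<Rightarrow> ('g \<times> 'g rep set) set"
  where "gabor_support m \<psi> f =
     {(x, c). c \<in> unitary_dual \<and> (\<exists>u \<in> fst (class_rep c). gabor m \<psi> f x (class_rep c) u \<noteq> 0)}"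

text \<open>The explicit measurability premise keeps the convention that
  \<^const>\<open>emeasure\<close> vanishes on non-measurable sets from playing any role.\<close>

definition weak_QUP_gabor ::
    "'g::topological_group_add measure \<Rightarrow> 'g rep set measure \<Rightarrow> bool" where
  "weak_QUP_gabor m \<mu> \<longleftrightarrow>
     (\<forall>f \<psi>. f \<in> L2 m \<longrightarrow> window m \<psi> \<longrightarrow>
        gabor_support m \<psi> f \<in> sets (m \<Otimes>\<^sub>M \<mu>) \<longrightarrow>
        emeasure (m \<Otimes>\<^sub>M \<mu>) (gabor_support m \<psi> f) < 1 \<longrightarrow>
        (AE x in m. f x = 0))"


section \<open>The group as an algebraic structure, and its identity component\<close>

definition group_of :: "'g::group_add itself \<Rightarrow> 'g monoid"
  where "group_of _ = \<lparr>carrier = UNIV, monoid.mult = (+), one = 0\<rparr>"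

definition identity_component :: "'g::topological_group_add set"
  where "identity_component = connected_component_set UNIV 0"

end

theory Submission
  imports Defs
begin

text \<open>Write \<open>G\<^sub>0\<close> for the identity component and let \<open>K\<close> be a compact open subgroup.  The idea is to feed the
indicator \<open>1\<^sub>K\<close>, both as signal and as window, to the uncertainty principle.  Its Gabor transform at
\<open>(x, \<pi>)\<close> vanishes unless \<open>x \<in> K\<close>, and then it is \<open>m(K)\<close> times the projection of the space of \<open>\<pi>\<close>
onto the \<open>K\<close>-fixed vectors.  The support is therefore \<open>K \<times> S\<close>, where \<open>S\<close> is the set of those \<open>\<pi>\<close>
that have a nonzero \<open>K\<close>-fixed vector (\<open>gabor_support_indicator\<close>), and the uncertainty principle
forces \<open>m(K) \<mu>(S) \<ge> 1\<close> (\<open>weak_QUP_imp_fixed_dual_ge\<close>).  On the other hand the Plancherel formula for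
\<open>1\<^sub>K\<close> reads
\<open>m(K) = m(K)\<^sup>2 \<integral> dim(K-fixed vectors of \<pi>) d\<mu>\<close>.
Both together leave room for dimension one only: almost every \<open>\<pi>\<close> with a \<open>K\<close>-fixed vector has exactly
a line of them.  A representation on which \<open>K\<close> acts trivially and on which some commutator \<open>x\<close> acts
nontrivially has dimension at least two, so these representations form a null set
(\<open>weak_QUP_imp_nontrivial_dual_null\<close>).

Suppose now that a commutator \<open>x\<close> lies outside \<open>G\<^sub>0\<close>.  As \<open>G\<^sub>0\<close> is compact, it is the intersection of
compact open subgroups (\<open>compact_open_subgroup_in_nbhd\<close>), and one of them, \<open>K\<close>, misses \<open>x\<close>.  Let \<open>f\<close>
be the difference of the indicators of \<open>K\<close> and of its coset \<open>x + K\<close>.  If the Fourier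
transform of \<open>f\<close> at \<open>\<pi>\<close> is nonzero, then \<open>\<pi>\<close> has a \<open>K\<close>-fixed vector and \<open>\<pi>(x) \<noteq> 1\<close>.  By irreducibility
\<open>\<pi>\<close> is trivial on the normal subgroup \<open>G\<^sub>0 \<subseteq> K\<close>; by the Moore property \<open>\<pi>\<close> is finite-dimensional, and
since unitary groups have no small subgroups, \<open>\<pi>\<close> is trivial on some compact open subgroup \<open>K'\<close>
(\<open>acts_trivially_on_nbhd\<close>).  So \<open>\<pi>\<close> belongs to the null set attached to \<open>K'\<close>.  There are only
countably many compact open subgroups, hence the Fourier transform of \<open>f\<close> vanishes almost everywhere
and the Plancherel formula gives \<open>f = 0\<close> almost everywhere, which is absurd
(\<open>commutator_mem_identity_component\<close>).

What remains is measurability in the Mackey Borel structure.  The sets of representations above are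
described by countably many conditions on matrix coefficients, using countable dense subsets of the
group and of the representation space (\<open>sets_has_fixed_vector\<close>, \<open>sets_acts_trivially\<close>).\<close>

section \<open>The complex inner product\<close>


lemma cinner_commute: "cinner u v = cnj (cinner v u)"
proof -
  have "(\<lambda>i. cnj (coord v i * cnj (coord u i))) sums cnj (cinner v u)"
    unfolding cinner_def by (intro sums_cnj[THEN iffD2] summable_sums summable_coord_mult_cnj)
  then show ?thesis
    unfolding cinner_def[of u] by (simp add: mult.commute sums_iff)
qed

lemma cinner_add_right: "cinner w (u + v) = cinner w u + cinner w v"
  using arg_cong[OF cinner_add_left_ell2[of u v w], of cnj] by (simp flip: cinner_commute)

lemma cinner_cscale_right: "cinner w (cscale c u) = cnj c * cinner w u"
  using arg_cong[OF cinner_cscale_left_ell2[of c u w], of cnj] by (simp flip: cinner_commute)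

lemma cscale_minus_one: "cscale (- 1) v = - v"
  by (rule uminus_ell2_def[symmetric])

lemma cinner_minus_left: "cinner (- u) w = - cinner u w"
  using cinner_cscale_left_ell2[of "-1" u w] by (simp add: cscale_minus_one)

lemma cinner_minus_right: "cinner w (- u) = - cinner w u"
  using cinner_cscale_right[of w "-1" u] by (simp add: cscale_minus_one)

lemma cinner_diff_left: "cinner (u - v) w = cinner u w - cinner v w"
  using cinner_add_left_ell2[of u "- v" w] by (simp add: cinner_minus_left)

lemma cinner_diff_right: "cinner w (u - v) = cinner w u - cinner w v"
  using cinner_add_right[of w u "- v"] by (simp add: cinner_minus_right)

lemma cinner_zero_left [simp]: "cinner 0 w = 0"
  using cinner_diff_left[of 0 0 w] by simp

lemma cinner_zero_right [simp]: "cinner w 0 = 0"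
  using cinner_diff_right[of w 0 0] by simp

lemma cinner_sum_left: "cinner (\<Sum>i\<in>A. f i) w = (\<Sum>i\<in>A. cinner (f i) w)"
  by (induction A rule: infinite_finite_induct) (auto simp: cinner_add_left_ell2)

lemma cinner_self: "cinner v v = of_real ((norm v)\<^sup>2)"
proof -
  have "Im (cinner v v) = 0"
    using cinner_commute[of v v] by (metis complex_cnj_cancel_iff Reals_cnj_iff complex_is_Real_iff)
  moreover have "Re (cinner v v) = (norm v)\<^sup>2"
    by (simp add: power2_norm_eq_inner inner_ell2_def)
  ultimately show ?thesis by (simp add: complex_eq_iff)
qed

lemma cinner_eq_zero_iff: "cinner v v = 0 \<longleftrightarrow> v = 0"
  by (simp add: cinner_self)

lemma of_real_cmod_square: "(complex_of_real (cmod z))\<^sup>2 = z * cnj z"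
  using complex_norm_square[of z] by simp

lemma norm_cscale: "norm (cscale c v) = cmod c * norm v"
proof -
  have "complex_of_real ((norm (cscale c v))\<^sup>2) = of_real ((cmod c * norm v)\<^sup>2)"
    unfolding cinner_self[symmetric] cinner_cscale_left_ell2 cinner_cscale_right power_mult_distrib
    by (simp add: cinner_self of_real_cmod_square)
  then have "(norm (cscale c v))\<^sup>2 = (cmod c * norm v)\<^sup>2"
    using of_real_eq_iff by blast
  then show ?thesis by (simp add: power2_eq_iff_nonneg)
qed

text \<open>Cauchy--Schwarz: rotating \<open>u\<close> by a phase makes the complex inner product real, where the
  inequality for the underlying real inner product space applies.\<close>

lemma cmod_cinner_le: "cmod (cinner u v) \<le> norm u * norm v"
proof (cases "cinner u v = 0")
  case False
  define d where "d = cnj (cinner u v) / of_real (cmod (cinner u v))"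
  have "cinner (cscale d u) v = of_real (cmod (cinner u v))"
    using False by (simp add: d_def cinner_cscale_left_ell2 mult.commute[of "cnj _"]
        of_real_cmod_square[symmetric] power2_eq_square)
  then have "cmod (cinner u v) = inner (cscale d u) v"
    by (simp add: inner_ell2_def)
  also have "\<dots> \<le> norm (cscale d u) * norm v"
    by (rule norm_cauchy_schwarz)
  also have "norm (cscale d u) = norm u"
    using False by (simp add: norm_cscale d_def norm_divide)
  finally show ?thesis .
qed simp

text \<open>Expresses the complex inner product through the real one, from which it inherits continuity.\<close>

lemma cinner_conv_inner:
  "cinner u v = of_real (inner u v) + \<i> * of_real (inner (cscale (- \<i>) u) v)"
  by (simp add: complex_eq_iff inner_ell2_def cinner_cscale_left_ell2 cinner_minus_left)

lemma continuous_on_cinner_right [continuous_intros]: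
  assumes "continuous_on S f"
  shows "continuous_on S (\<lambda>x. cinner u (f x))"
  unfolding cinner_conv_inner by (intro continuous_intros assms)

lemma continuous_on_cinner_left [continuous_intros]:
  assumes "continuous_on S f"
  shows "continuous_on S (\<lambda>x. cinner (f x) u)"
  by (subst cinner_commute) (intro continuous_intros assms)

lemma cinner_ext:
  assumes "u \<in> H" "v \<in> H" "cvec.subspace H" "\<And>w. w \<in> H \<Longrightarrow> cinner u w = cinner v w"
  shows "u = v"
proof -
  have "u - v \<in> H" using assms cvec.subspace_diff by blast
  then have "cinner (u - v) (u - v) = 0"
    using assms(4) by (simp add: cinner_diff_left)
  then show ?thesis by (simp add: cinner_self)
qed

lemma closed_csubspace_zero_mem: "closed_csubspace H \<Longrightarrow> 0 \<in> H"
  by (simp add: closed_csubspace_def cvec.subspace_0)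


section \<open>Orthonormal bases of finite-dimensional subspaces\<close>

text \<open>The expansion property replaces the density of the span: this is the form in which
finite-dimensional orthonormal bases enter all computations below.\<close>

definition finite_onb :: "ell2 set \<Rightarrow> ell2 set \<Rightarrow> bool" where
  "finite_onb H B \<longleftrightarrow> finite B \<and> B \<subseteq> H \<and> cvec.subspace H \<and>
     (\<forall>e\<in>B. \<forall>e'\<in>B. cinner e e' = (if e = e' then 1 else 0)) \<and>
     (\<forall>v\<in>H. v = (\<Sum>e\<in>B. cscale (cinner v e) e))"

lemma finite_onb_expand:
  "finite_onb H B \<Longrightarrow> v \<in> H \<Longrightarrow> v = (\<Sum>e\<in>B. cscale (cinner v e) e)"
  by (auto simp: finite_onb_def)

lemma finite_onb_norm1: "finite_onb H B \<Longrightarrow> e \<in> B \<Longrightarrow> norm e = 1"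
  using cinner_self[of e] unfolding finite_onb_def
  by (metis norm_ge_zero of_real_1 of_real_eq_iff power2_eq_1_iff abs_of_nonneg real_sqrt_abs real_sqrt_one)

lemma cinner_orthonormal_sum:
  assumes "finite B" "\<And>e e'. e \<in> B \<Longrightarrow> e' \<in> B \<Longrightarrow> cinner e e' = (if e = e' then 1 else 0)" "d \<in> B"
  shows "cinner (\<Sum>e\<in>B. cscale (f e) e) d = f d"
proof -
  have "cinner (\<Sum>e\<in>B. cscale (f e) e) d = (\<Sum>e\<in>B. if e = d then f e else 0)"
    unfolding cinner_sum_left cinner_cscale_left_ell2 using assms by (intro sum.cong) auto
  then show ?thesis using assms by simp
qed

text \<open>An orthonormal set is linearly independent, hence finite inside a finite-dimensional space.  The
difference between a vector and its expansion is orthogonal to the span, so by continuity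
to the closure of the span, that is, to the whole space.\<close>

lemma orthonormal_basis_imp_finite_onb:
  assumes "orthonormal_basis H B" "finite_dim H" "closed_csubspace H"
  shows "finite_onb H B"
proof -
  have on: "\<And>e e'. e \<in> B \<Longrightarrow> e' \<in> B \<Longrightarrow> cinner e e' = (if e = e' then 1 else 0)"
    and sub: "B \<subseteq> H" and cl: "closure (cvec.span B) = H"
    using assms(1) by (auto simp: orthonormal_basis_def)
  have subH: "cvec.subspace H" using assms(3) by (simp add: closed_csubspace_def)
  obtain T where T: "finite T" "H = cvec.span T"
    using assms(2) by (auto simp: finite_dim_def)
  have "cvec.independent B"
    unfolding cvec.independent_explicit_finite_subsets
  proof (intro allI impI ballI)
    fix S u v
    assume "S \<subseteq> B" "finite S" "(\<Sum>w\<in>S. cscale (u w) w) = 0" "v \<in> S"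
    then show "u v = 0"
      using cinner_orthonormal_sum[of S v u] on by (metis cinner_zero_left subsetD)
  qed
  then have fin: "finite B"
    using cvec.independent_span_bound[OF T(1)] sub T(2) by blast
  have "v = (\<Sum>e\<in>B. cscale (cinner v e) e)" if v: "v \<in> H" for v
  proof -
    define w where "w = v - (\<Sum>e\<in>B. cscale (cinner v e) e)"
    have wH: "w \<in> H"
      unfolding w_def using v sub subH
      by (intro cvec.subspace_diff cvec.subspace_sum cvec.subspace_scale) auto
    have "cinner w e = 0" if "e \<in> B" for e
      using cinner_orthonormal_sum[OF fin on that] by (simp add: w_def cinner_diff_left)
    then have "cvec.span B \<subseteq> {x. cinner w x = 0}"
      by (intro cvec.span_minimal)
        (auto simp: cvec.subspace_def cinner_add_right cinner_cscale_right)
    moreover have "closed {x. cinner w x = 0}"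
      by (intro closed_Collect_eq continuous_intros)
    ultimately have "H \<subseteq> {x. cinner w x = 0}"
      using closure_minimal cl by blast
    then have "cinner w w = 0" using wH by blast
    then show ?thesis by (simp add: cinner_self w_def)
  qed
  then show ?thesis
    using fin sub subH on by (simp add: finite_onb_def)
qed

text \<open>Gram--Schmidt: each new vector is replaced by its normalised component orthogonal to the
  vectors found so far, or dropped if that component vanishes.\<close>

lemma gram_schmidt:
  assumes "finite S"
  shows "\<exists>B. finite B \<and> cvec.span B = cvec.span S \<and>
     (\<forall>e\<in>B. \<forall>e'\<in>B. cinner e e' = (if e = e' then 1 else 0))"
  using assms
proof (induction S)
  case empty
  then show ?case by (intro exI[of _ "{}"]) auto
next
  case (insert v S)
  then obtain B where B: "finite B" "cvec.span B = cvec.span S"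
    and on: "\<And>e e'. e \<in> B \<Longrightarrow> e' \<in> B \<Longrightarrow> cinner e e' = (if e = e' then 1 else 0)"
    by blast
  define p where "p = (\<Sum>e\<in>B. cscale (cinner v e) e)"
  define w where "w = v - p"
  have p: "p \<in> cvec.span B"
    unfolding p_def by (intro cvec.span_sum cvec.span_scale cvec.span_base)
  have orth: "cinner w e = 0" if "e \<in> B" for e
    using cinner_orthonormal_sum[OF B(1) on that] by (simp add: w_def p_def cinner_diff_left)
  have span: "cvec.span (insert v S) = cvec.span (insert w B)"
  proof -
    have "cvec.span (insert v S) = cvec.span (insert v B)"
      using B(2) by (metis cvec.span_insert)
    also have "\<dots> = cvec.span (insert w B)"
      unfolding w_def by (rule cvec.eq_span_insert_eq) (use p in \<open>simp add: cvec.span_diff\<close>)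
    finally show ?thesis .
  qed
  show ?case
  proof (cases "w = 0")
    case True
    then have "cvec.span B = cvec.span (insert v S)"
      using span by simp
    then show ?thesis using B on by blast
  next
    case False
    define e0 where "e0 = cscale (of_real (inverse (norm w))) w"
    have we0: "w = cscale (of_real (norm w)) e0"
      using False by (simp add: e0_def)
    have e0: "cinner e0 e0 = 1"
    proof -
      have "norm e0 = 1"
        unfolding e0_def norm_cscale using False by (simp add: norm_inverse)
      then show ?thesis by (simp add: cinner_self)
    qed
    have o1: "cinner e0 e = 0" if "e \<in> B" for e
      using orth[OF that] by (simp add: e0_def cinner_cscale_left_ell2)
    then have o2: "cinner e e0 = 0" if "e \<in> B" for e
      using that by (subst cinner_commute) simp
    have "e0 \<notin> B" using e0 o1 by force
    have "cvec.span (insert w B) = cvec.span (insert e0 B)"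
    proof (rule antisym; rule cvec.span_minimal)
      show "insert w B \<subseteq> cvec.span (insert e0 B)"
        by (subst we0) (auto intro: cvec.span_scale cvec.span_base)
      show "insert e0 B \<subseteq> cvec.span (insert w B)"
        unfolding e0_def by (auto intro: cvec.span_scale cvec.span_base)
    qed auto
    then show ?thesis
      using B(1) on e0 o1 o2 \<open>e0 \<notin> B\<close> span
      by (intro exI[of _ "insert e0 B"]) auto
  qed
qed

lemma orthonormal_basis_exists:
  assumes "finite_dim H" "closed_csubspace H"
  shows "\<exists>B. orthonormal_basis H B"
proof -
  obtain S where S: "finite S" "H = cvec.span S"
    using assms(1) by (auto simp: finite_dim_def)
  obtain B where "cvec.span B = cvec.span S"
    "\<forall>e\<in>B. \<forall>e'\<in>B. cinner e e' = (if e = e' then 1 else 0)"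
    using gram_schmidt[OF S(1)] by blast
  then show ?thesis
    using assms(2) S(2) cvec.span_superset[of B]
    by (intro exI[of _ B]) (auto simp: orthonormal_basis_def closed_csubspace_def)
qed

lemma finite_onb_exists:
  "finite_dim H \<Longrightarrow> closed_csubspace H \<Longrightarrow> \<exists>B. finite_onb H B"
  using orthonormal_basis_exists orthonormal_basis_imp_finite_onb by blast

text \<open>The basis selected inside the Hilbert--Schmidt norm is some orthonormal basis, and its choice
depends on the space alone; so one finite basis serves all operators on it.\<close>

lemma hs_norm_sq_onb:
  assumes "finite_dim H" "closed_csubspace H"
  obtains B where "finite_onb H B" "\<And>T. hs_norm_sq H T = (\<Sum>e\<in>B. ennreal ((norm (T e))\<^sup>2))"
proof -
  define B where "B = (SOME B. orthonormal_basis H B)"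
  have "orthonormal_basis H B"
    unfolding B_def by (rule someI_ex[OF orthonormal_basis_exists[OF assms]])
  then have "finite_onb H B"
    using assms orthonormal_basis_imp_finite_onb by blast
  then show ?thesis
    by (intro that[of B]) (auto simp: hs_norm_sq_def B_def[symmetric] finite_onb_def)
qed

lemma parseval:
  assumes "finite_onb H B" "v \<in> H"
  shows "(\<Sum>e\<in>B. (cmod (cinner e v))\<^sup>2) = (norm v)\<^sup>2"
proof -
  have "complex_of_real ((norm v)\<^sup>2) = cinner (\<Sum>e\<in>B. cscale (cinner v e) e) v"
    using finite_onb_expand[OF assms] cinner_self by metis
  also have "\<dots> = (\<Sum>e\<in>B. cinner v e * cinner e v)"
    by (simp add: cinner_sum_left cinner_cscale_left_ell2)
  also have "\<dots> = (\<Sum>e\<in>B. of_real ((cmod (cinner e v))\<^sup>2))"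
    by (rule sum.cong[OF refl], subst cinner_commute) (simp add: of_real_cmod_square mult.commute)
  also have "\<dots> = of_real (\<Sum>e\<in>B. (cmod (cinner e v))\<^sup>2)" by simp
  finally show ?thesis using of_real_eq_iff by metis
qed

text \<open>In finite dimension, conjugate-linear functionals are represented by inner products with no
  appeal to completeness.\<close>

lemma finite_dim_riesz:
  assumes "finite_onb H B"
    and add: "\<And>v w. v \<in> H \<Longrightarrow> w \<in> H \<Longrightarrow> \<phi> (v + w) = \<phi> v + \<phi> w"
    and scale: "\<And>c v. v \<in> H \<Longrightarrow> \<phi> (cscale c v) = cnj c * \<phi> v"
  shows "\<exists>w\<in>H. \<forall>v\<in>H. cinner w v = \<phi> v"
proof
  have B: "finite B" "B \<subseteq> H" "cvec.subspace H" using assms by (auto simp: finite_onb_def)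
  show "(\<Sum>e\<in>B. cscale (\<phi> e) e) \<in> H"
    using B by (intro cvec.subspace_sum cvec.subspace_scale) auto
  have \<phi>0: "\<phi> 0 = 0"
    using scale[of 0 0] B(3) by (simp add: cvec.subspace_0)
  have \<phi>sum: "\<phi> (\<Sum>e\<in>A. cscale (g e) e) = (\<Sum>e\<in>A. cnj (g e) * \<phi> e)" if "finite A" "A \<subseteq> H" for A g
    using that
  proof (induction A)
    case (insert a A)
    then have "(\<Sum>e\<in>A. cscale (g e) e) \<in> H"
      using B(3) by (intro cvec.subspace_sum cvec.subspace_scale) auto
    then show ?case using insert B(3) by (simp add: add scale cvec.subspace_scale)
  qed (simp add: \<phi>0)
  show "\<forall>v\<in>H. cinner (\<Sum>e\<in>B. cscale (\<phi> e) e) v = \<phi> v"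
  proof
    fix v assume v: "v \<in> H"
    have "\<phi> v = (\<Sum>e\<in>B. cnj (cinner v e) * \<phi> e)"
      using \<phi>sum[OF B(1,2), of "cinner v"] finite_onb_expand[OF assms(1) v] by simp
    also have "\<dots> = (\<Sum>e\<in>B. \<phi> e * cinner e v)"
      by (rule sum.cong[OF refl], subst cinner_commute) simp
    finally show "cinner (\<Sum>e\<in>B. cscale (\<phi> e) e) v = \<phi> v"
      by (simp add: cinner_sum_left cinner_cscale_left_ell2)
  qed
qed

text \<open>Finite combinations of basis vectors with coefficients in a countable dense set of complex numbers.\<close>

lemma countable_dense_in_finite_dim:
  assumes "finite_onb H B"
  obtains D where "countable D" "D \<subseteq> H" "\<And>v r. v \<in> H \<Longrightarrow> 0 < r \<Longrightarrow> \<exists>u\<in>D. norm (u - v) < r"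
proof -
  have B: "finite B" "B \<subseteq> H" "cvec.subspace H" using assms by (auto simp: finite_onb_def)
  obtain Q :: "complex set" where Q: "countable Q"
    "\<And>X. open X \<Longrightarrow> X \<noteq> {} \<Longrightarrow> \<exists>d\<in>Q. d \<in> X"
    by (rule countable_dense_setE) blast
  define D where "D = (\<lambda>q. \<Sum>e\<in>B. cscale (q e) e) ` (\<Pi>\<^sub>E e\<in>B. Q)"
  show ?thesis
  proof
    show "countable D" unfolding D_def using Q(1) B(1) by (intro countable_image countable_PiE)
    show "D \<subseteq> H"
      unfolding D_def using B by (auto intro!: cvec.subspace_sum cvec.subspace_scale)
  next
    fix v and r :: real assume v: "v \<in> H" and r: "0 < r"
    define s where "s = r / (card B + 1)"
    have s: "0 < s" using r by (simp add: s_def)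
    have "\<exists>d\<in>Q. dist (cinner v e) d < s" for e
      using Q(2)[of "ball (cinner v e) s"] s by auto
    then obtain q where q: "\<And>e. q e \<in> Q" "\<And>e. dist (cinner v e) (q e) < s" by metis
    define u where "u = (\<Sum>e\<in>B. cscale (q e) e)"
    have "u = (\<Sum>e\<in>B. cscale (restrict q B e) e)" by (simp add: u_def)
    moreover have "restrict q B \<in> (\<Pi>\<^sub>E e\<in>B. Q)" using q by auto
    ultimately have uD: "u \<in> D" unfolding D_def by (rule image_eqI)
    have "u - v = (\<Sum>e\<in>B. cscale (q e - cinner v e) e)"
      by (subst finite_onb_expand[OF assms v])
        (simp add: u_def sum_subtractf[symmetric] cvec.scale_left_diff_distrib)
    then have "norm (u - v) \<le> (\<Sum>e\<in>B. norm (cscale (q e - cinner v e) e))"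
      by (simp add: norm_sum)
    also have "\<dots> \<le> (\<Sum>e\<in>B. s)"
      using q(2) finite_onb_norm1[OF assms]
      by (intro sum_mono) (simp add: norm_cscale dist_norm norm_minus_commute less_imp_le)
    also have "\<dots> < r" using r by (simp add: s_def field_simps)
    finally show "\<exists>u\<in>D. norm (u - v) < r" using uD by blast
  qed
qed


section \<open>Compact open subgroups\<close>

definition compact_open_subgroup :: "'g::topological_group_add set \<Rightarrow> bool" where
  "compact_open_subgroup K \<longleftrightarrow> compact K \<and> open K \<and> 0 \<in> K \<and>
     (\<forall>x\<in>K. \<forall>y\<in>K. x + y \<in> K) \<and> (\<forall>x\<in>K. - x \<in> K)"

lemma compact_open_subgroupD:
  assumes "compact_open_subgroup K"
  shows "compact K" "open K" "0 \<in> K" "\<And>x y. x \<in> K \<Longrightarrow> y \<in> K \<Longrightarrow> x + y \<in> K"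
    "\<And>x. x \<in> K \<Longrightarrow> - x \<in> K"
  using assms by (auto simp: compact_open_subgroup_def)

lemma subgroup_translate_mem_iff:
  assumes "compact_open_subgroup K" "k \<in> K"
  shows "k + y \<in> K \<longleftrightarrow> y \<in> K"
  using compact_open_subgroupD(4,5)[OF assms(1)] assms(2) by (metis minus_add_cancel)

lemma image_add_eq_vimage: "(+) (x :: 'a::group_add) ` A = (+) (- x) -` A"
proof (intro equalityI subsetI)
  fix y assume "y \<in> (+) (- x) -` A"
  then show "y \<in> (+) x ` A" by (intro image_eqI[of _ _ "- x + y"]) auto
qed auto

lemma zero_in_identity_component: "0 \<in> identity_component"
  by (simp add: identity_component_def connected_component_refl)

lemma connected_subset_identity_component:
  "connected S \<Longrightarrow> 0 \<in> S \<Longrightarrow> S \<subseteq> identity_component"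
  unfolding identity_component_def by (rule connected_component_maximal) auto

lemma connected_identity_component: "connected identity_component"
  by (simp add: identity_component_def)

text \<open>A connected set containing \<open>0\<close> lies in the identity component; this is applied to left translates
of the component by the negative of one of its elements.  It also gives invariance under conjugation.\<close>

lemma identity_component_subgroup:
  fixes x y :: "'g::topological_group_add"
  assumes "x \<in> identity_component"
  shows identity_component_uminus: "- x \<in> identity_component"
    and identity_component_add: "y \<in> identity_component \<Longrightarrow> x + y \<in> identity_component"
proof -
  have diff: "- x + y \<in> identity_component"
    if "x \<in> identity_component" "y \<in> identity_component" for x y :: 'g
  proof -
    have "(\<lambda>z. - x + z) ` identity_component \<subseteq> identity_component"
    proof (rule connected_subset_identity_component)
      show "connected ((\<lambda>z. - x + z) ` identity_component)"
        by (intro connected_continuous_image continuous_intros connected_identity_component)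
      show "0 \<in> (\<lambda>z. - x + z) ` identity_component"
        using that(1) by (intro image_eqI[of _ _ x]) auto
    qed
    then show ?thesis using that(2) by blast
  qed
  show "- x \<in> identity_component"
    using diff[OF assms zero_in_identity_component] by simp
  then show "y \<in> identity_component \<Longrightarrow> x + y \<in> identity_component"
    using diff[of "- x" y] by simp
qed

lemma identity_component_conj:
  fixes x y :: "'g::topological_group_add"
  assumes "y \<in> identity_component"
  shows "x + y + - x \<in> identity_component"
proof -
  have "(\<lambda>z. x + z + - x) ` identity_component \<subseteq> identity_component"
  proof (rule connected_subset_identity_component)
    show "connected ((\<lambda>z. x + z + - x) ` identity_component)"
      by (intro connected_continuous_image continuous_intros connected_identity_component)
    show "0 \<in> (\<lambda>z. x + z + - x) ` identity_component"
      using zero_in_identity_component by (intro image_eqI[of _ _ 0]) auto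
  qed
  then show ?thesis using assms by blast
qed

lemma identity_component_subset_subgroup:
  fixes K :: "'g::{topological_group_add, t2_space} set"
  assumes "compact_open_subgroup K"
  shows "identity_component \<subseteq> K"
proof -
  have "closed K" "open K" "0 \<in> K"
    using compact_open_subgroupD[OF assms] compact_imp_closed by auto
  then show ?thesis
    using connectedD[OF connected_identity_component, of K "- K"] zero_in_identity_component
    by (auto simp: open_Compl)
qed

text \<open>The right stabiliser of \<open>C\<close> is a subgroup, and it lies in \<open>C\<close> because \<open>0 \<in> C\<close>.  By the tube lemma
some neighbourhood \<open>U\<close> of \<open>0\<close> satisfies \<open>C + U \<subseteq> C\<close>, so the stabiliser is open; being an open subgroup
it is closed, hence compact.\<close>

lemma compact_clopen_contains_subgroup:
  fixes C :: "'g::{topological_group_add, t2_space} set"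
  assumes "compact C" "open C" "0 \<in> C"
  shows "\<exists>K. compact_open_subgroup K \<and> K \<subseteq> C"
proof -
  define K where "K = {g. (\<forall>c\<in>C. c + g \<in> C) \<and> (\<forall>c\<in>C. c + - g \<in> C)}"
  have K0: "0 \<in> K" by (simp add: K_def)
  have Kadd: "x + y \<in> K" if "x \<in> K" "y \<in> K" for x y
    using that by (simp add: K_def diff_add_eq_diff_diff_swap add.assoc[symmetric])
  have Kneg: "- x \<in> K" if "x \<in> K" for x
    using that by (simp add: K_def)
  have KC: "K \<subseteq> C" using assms(3) by (force simp: K_def)
  have "open ((\<lambda>p. snd p + fst p) -` C :: ('g \<times> 'g) set)"
    by (intro open_vimage assms continuous_intros)
  then have "\<exists>U. 0 \<in> U \<and> open U \<and> U \<times> C \<subseteq> (\<lambda>p. snd p + fst p) -` C"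
    by (rule Elementary_Topology.tube_lemma[OF assms(1)]) auto
  then obtain U where "0 \<in> U" "open U" "U \<times> C \<subseteq> (\<lambda>p. snd p + fst p) -` C"
    by blast
  then have U: "0 \<in> U" "open U" "\<And>u c. u \<in> U \<Longrightarrow> c \<in> C \<Longrightarrow> c + u \<in> C"
    by auto
  have "open (uminus -` U :: 'g set)"
    by (intro open_vimage U continuous_intros)
  then have W: "open (U \<inter> uminus -` U)" "0 \<in> U \<inter> uminus -` U" "U \<inter> uminus -` U \<subseteq> K"
    using U by (auto simp: K_def simp del: add_uminus_conv_diff)
  have nbhd: "\<exists>T. open T \<and> x \<in> T \<and> T \<subseteq> K" if x: "x \<in> K" for x
  proof (intro exI conjI)
    show "open ((+) (- x) -` (U \<inter> uminus -` U))"
      by (intro open_vimage W continuous_intros)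
    show "x \<in> (+) (- x) -` (U \<inter> uminus -` U)" using W by simp
    show "(+) (- x) -` (U \<inter> uminus -` U) \<subseteq> K"
    proof
      fix y assume "y \<in> (+) (- x) -` (U \<inter> uminus -` U)"
      then have "- x + y \<in> K" using W(3) by blast
      then have "x + (- x + y) \<in> K" using x Kadd by blast
      then show "y \<in> K" by simp
    qed
  qed
  then have "open K" by (subst open_subopen) blast
  moreover have "closed K"
  proof -
    have "\<exists>T. open T \<and> x \<in> T \<and> T \<subseteq> - K" if x: "x \<in> - K" for x
    proof (intro exI conjI)
      show "open ((+) (- x) -` K)" by (intro open_vimage \<open>open K\<close> continuous_intros)
      show "x \<in> (+) (- x) -` K" using K0 by simp
      show "(+) (- x) -` K \<subseteq> - K"
      proof
        fix y assume y: "y \<in> (+) (- x) -` K"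
        have "x \<in> K" if "y \<in> K"
        proof -
          have "y + - (- x + y) \<in> K" using that y Kadd[of y "- (- x + y)"] Kneg[of "- x + y"] by simp
          then show ?thesis by (simp add: minus_add)
        qed
        then show "y \<in> - K" using x by blast
      qed
    qed
    then have "open (- K)" by (subst open_subopen) blast
    then show ?thesis by (simp add: closed_def)
  qed
  then have "compact K"
    using KC assms(1) compact_Int_closed[of C K] by (simp add: Int_absorb1)
  ultimately show ?thesis
    using K0 Kadd Kneg KC by (auto simp: compact_open_subgroup_def)
qed

lemma Hausdorff_space_euclidean_t2: "Hausdorff_space (euclidean :: 'a::t2_space topology)"
  unfolding Hausdorff_space_def disjnt_def using hausdorff by fastforce

text \<open>The analogue of van Dantzig's theorem for a compact identity component.  A compact component of a
locally compact Hausdorff space has arbitrarily small clopen neighbourhoods, and these may be taken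
inside a compact set.\<close>

lemma compact_open_subgroup_in_nbhd:
  fixes U :: "'g::{topological_group_add, t2_space} set"
  assumes lc: "locally_compact_space (euclidean :: 'g topology)"
    and cpt: "compact (identity_component :: 'g set)"
    and U: "open U" "identity_component \<subseteq> U"
  shows "\<exists>K. compact_open_subgroup K \<and> K \<subseteq> U"
proof -
  let ?X = "euclidean :: 'g topology"
  have haus: "Hausdorff_space ?X" by (rule Hausdorff_space_euclidean_t2)
  have comp: "connected_component_of_set ?X 0 = (identity_component :: 'g set)"
    by (auto simp: identity_component_def connected_component_of_def connected_component_def)
  have comps: "(identity_component :: 'g set) \<in> connected_components_of ?X"
    using connected_component_in_connected_components_of[of ?X 0] comp by simp
  have "\<forall>K. compactin ?X K \<longrightarrow> (\<exists>U L. openin ?X U \<and> compactin ?X L \<and> closedin ?X L \<and> K \<subseteq> U \<and> U \<subseteq> L)"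
    using lc haus locally_compact_space_compact_closed_compact[of ?X] by blast
  then obtain V L where VL: "open V" "compact L" "(identity_component :: 'g set) \<subseteq> V" "V \<subseteq> L"
    using cpt by (auto dest!: spec[of _ identity_component])
  obtain C D where C: "openin ?X C" "openin ?X D" "disjnt C D" "C \<union> D = topspace ?X"
      "identity_component \<subseteq> C" "C \<subseteq> U \<inter> V"
    by (rule wilder_locally_compact_component_thm[OF lc haus comps, of "U \<inter> V"])
      (use cpt U VL in auto)
  have "C = - D" using C by (auto simp: disjnt_def)
  then have "closed C" using C by auto
  then have "compact C"
    using VL C(6) compact_Int_closed[of L C] by (metis Int_absorb1 Int_subset_iff subset_trans)
  moreover have "open C" "0 \<in> C" "C \<subseteq> U"
    using C zero_in_identity_component by auto
  ultimately show ?thesis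
    using compact_clopen_contains_subgroup[of C] by blast
qed

text \<open>A compact open set is a finite union of members of a countable base.\<close>

lemma countable_compact_open_sets:
  "countable {K :: 'a::second_countable_topology set. compact K \<and> open K}"
proof -
  obtain B :: "'a set set" where B: "countable B" "topological_basis B"
    by (rule ex_countable_basis[THEN exE]) auto
  have "{K. compact K \<and> open K} \<subseteq> Union ` {F. finite F \<and> F \<subseteq> B}"
  proof
    fix K :: "'a set" assume "K \<in> {K. compact K \<and> open K}"
    then have K: "compact K" "open K" by auto
    obtain B' where B': "B' \<subseteq> B" "\<Union>B' = K"
      using B(2) K(2) unfolding topological_basis_def by blast
    obtain F where "F \<subseteq> B'" "finite F" "K \<subseteq> \<Union>F"
      using compactE[OF K(1), of B'] B' B(2) topological_basis_open by (metis order_refl subsetD)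
    then show "K \<in> Union ` {F. finite F \<and> F \<subseteq> B}"
      using B' by (intro image_eqI[of _ _ F]) auto
  qed
  moreover have "countable {F. finite F \<and> F \<subseteq> B}"
    using B(1) by (rule countable_Collect_finite_subset)
  ultimately show ?thesis by (meson countable_image countable_subset)
qed

text \<open>Two elements of a quotient commute as soon as the commutator of their representatives is in
the normal subgroup.\<close>

lemma comm_quotient_by_identity_component:
  assumes "\<And>a b :: 'g. (a + b) + - (b + a) \<in> identity_component"
  shows "comm_group (group_of TYPE('g::topological_group_add) Mod (identity_component :: 'g set))"
proof -
  let ?G = "group_of TYPE('g)" and ?N = "identity_component :: 'g set"
  have car [simp]: "carrier ?G = UNIV" and mul [simp]: "\<And>x y. x \<otimes>\<^bsub>?G\<^esub> y = x + y"
    and one [simp]: "\<one>\<^bsub>?G\<^esub> = 0"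
    by (simp_all add: group_of_def)
  interpret G: group ?G
  proof (rule groupI)
    fix x :: 'g
    show "\<exists>y\<in>carrier ?G. y \<otimes>\<^bsub>?G\<^esub> x = \<one>\<^bsub>?G\<^esub>" by (intro bexI[of _ "- x"]) auto
  qed (auto simp: add.assoc)
  have inv [simp]: "inv\<^bsub>?G\<^esub> x = - x" for x
    by (rule G.inv_equality) auto
  have sub: "subgroup ?N ?G"
    by (rule G.subgroupI)
      (use zero_in_identity_component in \<open>auto intro: identity_component_uminus identity_component_add\<close>)
  have "?N \<lhd> ?G"
    using sub identity_component_conj
    by (auto simp: G.normal_inv_iff simp del: add_uminus_conv_diff)
  then interpret N: normal ?N ?G .
  have eq: "?N #>\<^bsub>?G\<^esub> (a + b) = ?N #>\<^bsub>?G\<^esub> (b + a)" for a b :: 'g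
  proof (rule G.repr_independence[OF _ _ sub])
    show "b + a \<in> ?N #>\<^bsub>?G\<^esub> (a + b)"
      using assms[of b a] by (force simp: r_coset_def)
  qed auto
  show ?thesis
  proof (rule group.group_comm_groupI[OF N.factorgroup_is_group])
    fix X Y assume "X \<in> carrier (?G Mod ?N)" "Y \<in> carrier (?G Mod ?N)"
    then obtain a b where "X = ?N #>\<^bsub>?G\<^esub> a" "Y = ?N #>\<^bsub>?G\<^esub> b"
      by (auto simp: carrier_FactGroup)
    then show "X \<otimes>\<^bsub>?G Mod ?N\<^esub> Y = Y \<otimes>\<^bsub>?G Mod ?N\<^esub> X"
      using N.rcos_sum[of a b] N.rcos_sum[of b a] eq[of a b] by simp
  qed
qed


section \<open>Haar measure\<close>

lemma haar_measure_sets [measurable_cong]: "haar_measure m \<Longrightarrow> sets m = sets borel"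
  by (simp add: haar_measure_def)

lemma haar_measure_space: "haar_measure m \<Longrightarrow> space m = UNIV"
  using sets_eq_imp_space_eq[OF haar_measure_sets] by auto

text \<open>If \<open>U\<close> were null, so would be all its left translates.  They cover the group, and by the Lindelof
property countably many of them suffice, so the whole group would be null.\<close>

lemma haar_measure_open_pos:
  fixes m :: "'g::{topological_group_add, t2_space, second_countable_topology} measure"
  assumes m: "haar_measure m" and "open U" "u \<in> U"
  shows "emeasure m U \<noteq> 0"
proof
  assume 0: "emeasure m U = 0"
  have op: "open ((+) x ` U)" for x :: 'g
    unfolding image_add_eq_vimage by (intro open_vimage \<open>open U\<close> continuous_intros)
  obtain F where F: "F \<subseteq> range (\<lambda>x. (+) x ` U)" "countable F" "\<Union>F = (\<Union>x. (+) x ` U)"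
    by (rule Lindelof[of "range (\<lambda>x. (+) x ` U)"]) (use op in auto)
  have "(\<Union>x. (+) x ` U) = (UNIV :: 'g set)"
  proof -
    have "y \<in> (+) (y - u) ` U" for y
      using assms(3) by (intro image_eqI[of _ _ u]) auto
    then show ?thesis by blast
  qed
  moreover have "(\<Union>A\<in>F. A) \<in> null_sets m"
  proof (rule null_sets_UN')
    fix A assume "A \<in> F"
    then obtain x where x: "A = (+) x ` U" using F(1) by blast
    have "emeasure m A = 0"
      using m 0 \<open>open U\<close> by (simp add: haar_measure_def x)
    then show "A \<in> null_sets m"
      using op[of x] x by (simp add: null_sets_def haar_measure_sets[OF m])
  qed (rule F(2))
  ultimately have "emeasure m UNIV = 0" using F(3) by auto
  then show False using m by (simp add: haar_measure_def)
qed

lemma haar_integral_translate: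
  fixes g :: "'g::{topological_group_add, t2_space, second_countable_topology} \<Rightarrow> complex"
  assumes m: "haar_measure m" and g: "g \<in> borel_measurable borel"
  shows "(LINT y|m. g (x + y)) = (LINT y|m. g y)"
proof -
  have tr: "(+) x \<in> borel_measurable m"
    unfolding measurable_cong_sets[OF haar_measure_sets[OF m] refl]
    by (intro borel_measurable_continuous_onI continuous_intros)
  have "distr m borel ((+) x) = m"
  proof (rule measure_eqI)
    fix A assume "A \<in> sets (distr m borel ((+) x))"
    then have A: "A \<in> sets borel" by simp
    have "(+) x -` A = (+) (- x) ` A" by (simp add: image_add_eq_vimage)
    then show "emeasure (distr m borel ((+) x)) A = emeasure m A"
      using m A tr by (simp add: emeasure_distr haar_measure_space[OF m] haar_measure_def)
  qed (simp add: haar_measure_sets[OF m])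
  then have "(LINT y|m. g y) = (LINT y|distr m borel ((+) x). g y)" by simp
  also have "\<dots> = (LINT y|m. g (x + y))"
    by (rule integral_distr[OF tr g])
  finally show ?thesis by simp
qed

lemma compact_open_subgroup_measure:
  fixes K :: "'g::{topological_group_add, t2_space, second_countable_topology} set"
  assumes m: "haar_measure m" and K: "compact_open_subgroup K"
  shows "K \<in> sets m" "emeasure m K = ennreal (measure m K)" "0 < measure m K"
proof -
  show "K \<in> sets m"
    using compact_open_subgroupD(2)[OF K] by (simp add: haar_measure_sets[OF m])
  have fin: "emeasure m K < \<infinity>"
    using m compact_open_subgroupD(1)[OF K] by (simp add: haar_measure_def)
  then show eq: "emeasure m K = ennreal (measure m K)"
    by (simp add: emeasure_eq_ennreal_measure)
  have "emeasure m K \<noteq> 0"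
    using haar_measure_open_pos[OF m compact_open_subgroupD(2,3)[OF K]] .
  then show "0 < measure m K"
    using eq by (metis ennreal_eq_0_iff not_less)
qed


section \<open>Finite-dimensional unitary representations\<close>

lemma unitary_repD:
  assumes "unitary_rep (H, \<pi>)"
  shows "closed_csubspace H" "cvec.subspace H" "closed H"
    "\<And>x v. v \<in> H \<Longrightarrow> \<pi> x v \<in> H"
    "\<And>x u v. u \<in> H \<Longrightarrow> v \<in> H \<Longrightarrow> \<pi> x (u + v) = \<pi> x u + \<pi> x v"
    "\<And>x c v. v \<in> H \<Longrightarrow> \<pi> x (cscale c v) = cscale c (\<pi> x v)"
    "\<And>x u v. u \<in> H \<Longrightarrow> v \<in> H \<Longrightarrow> cinner (\<pi> x u) (\<pi> x v) = cinner u v"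
    "\<And>x y v. v \<in> H \<Longrightarrow> \<pi> (x + y) v = \<pi> x (\<pi> y v)"
    "\<And>v. v \<in> H \<Longrightarrow> continuous_on UNIV (\<lambda>x. \<pi> x v)"
  using assms
  by (auto simp: unitary_rep_def unitary_between_def closed_csubspace_def intro: bij_betw_apply)

lemma unitary_rep_zero:
  assumes "unitary_rep (H, \<pi>)" "v \<in> H"
  shows "\<pi> 0 v = v"
proof -
  have "inj_on (\<pi> 0) H"
    using assms by (auto simp: unitary_rep_def unitary_between_def bij_betw_def)
  moreover have "\<pi> 0 (\<pi> 0 v) = \<pi> 0 v"
    using unitary_repD(8)[OF assms, of 0 0] by simp
  ultimately show ?thesis
    using unitary_repD(4)[OF assms(1)] assms(2) by (metis inj_onD)
qed

lemma unitary_rep_inverse: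
  assumes "unitary_rep (H, \<pi>)" "v \<in> H"
  shows "\<pi> x (\<pi> (- x) v) = v" "\<pi> (- x) (\<pi> x v) = v"
  using unitary_repD(8)[OF assms, of x "- x"] unitary_repD(8)[OF assms, of "- x" x]
    unitary_rep_zero[OF assms] by simp_all

lemma cinner_rep_left:
  assumes "unitary_rep (H, \<pi>)" "u \<in> H" "v \<in> H"
  shows "cinner (\<pi> x u) v = cinner u (\<pi> (- x) v)"
  using unitary_repD(7)[OF assms(1,2) unitary_repD(4)[OF assms(1,3)], of x "- x"]
    unitary_rep_inverse(1)[OF assms(1,3)] by simp

lemma unitary_rep_diff:
  assumes "unitary_rep (H, \<pi>)" "u \<in> H" "v \<in> H"
  shows "\<pi> x (u - v) = \<pi> x u - \<pi> x v"
  using unitary_repD(5)[OF assms(1), of "u - v" v x] assms cvec.subspace_diff[OF unitary_repD(2)[OF assms(1)]]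
  by simp

lemma unitary_rep_norm:
  assumes "unitary_rep (H, \<pi>)" "v \<in> H"
  shows "norm (\<pi> x v) = norm v"
  using unitary_repD(7)[OF assms assms(2), of x] unfolding cinner_self
  by (metis norm_ge_zero of_real_eq_iff power2_eq_iff_nonneg)

lemma unitary_rep_sum:
  assumes "unitary_rep (H, \<pi>)" "finite A" "A \<subseteq> H"
  shows "\<pi> x (\<Sum>e\<in>A. cscale (c e) e) = (\<Sum>e\<in>A. cscale (c e) (\<pi> x e))"
  using assms(2,3)
proof (induction A)
  case empty
  then show ?case
    using unitary_rep_diff[OF assms(1), of 0 0 x] unitary_repD(2)[OF assms(1)]
    by (simp add: cvec.subspace_0)
next
  case (insert a A)
  have sub: "cvec.subspace H" by (rule unitary_repD(2)[OF assms(1)])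
  have "(\<Sum>e\<in>A. cscale (c e) e) \<in> H"
    using sub insert by (intro cvec.subspace_sum cvec.subspace_scale) auto
  then show ?case
    using insert sub by (simp add: unitary_repD(5,6)[OF assms(1)] cvec.subspace_scale)
qed

lemma Re_cinner_rep:
  assumes "unitary_rep (H, \<pi>)" "v \<in> H"
  shows "Re (cinner (\<pi> x v) v) = (norm v)\<^sup>2 - (norm (\<pi> x v - v))\<^sup>2 / 2"
  using dot_norm_neg[of "\<pi> x v" v] unitary_rep_norm[OF assms, of x] by (simp add: inner_ell2_def)

text \<open>For unitary operators, a bound on the displacement of \<open>v\<close> is the same as a lower bound on the
diagonal coefficient at \<open>v\<close>.  The latter is stable under averaging over a subgroup.\<close>

lemma Re_cinner_rep_ge:
  assumes "unitary_rep (H, \<pi>)" "v \<in> H" "norm (\<pi> x v - v) \<le> norm v"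
  shows "(norm v)\<^sup>2 / 2 \<le> Re (cinner (\<pi> x v) v)"
  using Re_cinner_rep[OF assms(1,2), of x] power_mono[OF assms(3), of 2] by simp

lemma coefficient_measurable:
  assumes "unitary_rep (H, \<pi> :: 'g::{topological_group_add, t2_space, second_countable_topology} \<Rightarrow> _)" "v \<in> H"
  shows "(\<lambda>y. cinner u (\<pi> y v)) \<in> borel_measurable borel"
  by (intro borel_measurable_continuous_onI continuous_intros unitary_repD(9)[OF assms])

lemma coefficient_integrable:
  assumes "haar_measure m" "unitary_rep (H, \<pi>)" "v \<in> H" "integrable m f"
  shows "integrable m (\<lambda>y. f y * cinner u (\<pi> y v))"
proof (rule Bochner_Integration.integrable_bound)
  show "integrable m (\<lambda>y. f y * of_real (norm u * norm v))"
    using assms(4) by (intro integrable_mult_left)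
  have "(\<lambda>y. cinner u (\<pi> y v)) \<in> borel_measurable m"
    using coefficient_measurable[OF assms(2,3)]
    by (simp add: measurable_cong_sets[OF haar_measure_sets[OF assms(1)] refl])
  then show "(\<lambda>y. f y * cinner u (\<pi> y v)) \<in> borel_measurable m"
    using borel_measurable_integrable[OF assms(4)] by (rule borel_measurable_times[rotated])
  show "AE y in m. norm (f y * cinner u (\<pi> y v)) \<le> norm (f y * of_real (norm u * norm v))"
    using cmod_cinner_le[of u "\<pi> _ v"] unitary_rep_norm[OF assms(2,3)]
    by (auto simp: norm_mult intro!: mult_left_mono)
qed

lemma adjoint_on_rep:
  assumes "unitary_rep (H, \<pi>)" "u \<in> H"
  shows "adjoint_on H (\<pi> y) u \<in> H" "v \<in> H \<Longrightarrow> cinner (adjoint_on H (\<pi> y) u) v = cinner u (\<pi> y v)"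
proof -
  have "\<forall>u\<in>H. adjoint_on H (\<pi> y) u \<in> H \<and> (\<forall>v\<in>H. cinner (adjoint_on H (\<pi> y) u) v = cinner u (\<pi> y v))"
    unfolding adjoint_on_def
    by (rule someI[where x = "\<pi> (- y)"])
      (use cinner_rep_left[OF assms(1), of _ _ "- y"] unitary_repD(4)[OF assms(1)] in auto)
  then show "adjoint_on H (\<pi> y) u \<in> H" "v \<in> H \<Longrightarrow> cinner (adjoint_on H (\<pi> y) u) v = cinner u (\<pi> y v)"
    using assms(2) by auto
qed

text \<open>The adjoint and the weak integral are chosen by description, so they are known only once
operators with the required property are shown to exist.  The adjoint of \<open>\<pi>(y)\<close> is \<open>\<pi>(- y)\<close>, and in finite
dimension the weak integral comes from representing a conjugate-linear functional.\<close>

lemma fourier_coefficient: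
  assumes m: "haar_measure m" and rep: "unitary_rep (H, \<pi>)" and fin: "finite_dim H"
    and f: "integrable m f" and u: "u \<in> H"
  shows "fourier m f (H, \<pi>) u \<in> H"
    "v \<in> H \<Longrightarrow> cinner (fourier m f (H, \<pi>) u) v = (LINT y|m. f y * cinner u (\<pi> y v))"
proof -
  let ?F = "\<lambda>y u. cscale (f y) (adjoint_on H (\<pi> y) u)"
  obtain B where B: "finite_onb H B"
    using finite_onb_exists[OF fin unitary_repD(1)[OF rep]] by blast
  have coeff: "cinner (?F y u) v = f y * cinner u (\<pi> y v)" if "u \<in> H" "v \<in> H" for y u v
    using adjoint_on_rep(2)[OF rep that] by (simp add: cinner_cscale_left_ell2)
  have "\<exists>w\<in>H. \<forall>v\<in>H. cinner w v = (LINT y|m. cinner (?F y u) v)" if u: "u \<in> H" for u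
  proof (rule finite_dim_riesz[OF B])
    fix v w assume vw: "v \<in> H" "w \<in> H"
    then show "(LINT y|m. cinner (?F y u) (v + w)) = (LINT y|m. cinner (?F y u) v) + (LINT y|m. cinner (?F y u) w)"
      using coefficient_integrable[OF m rep _ f, of _ u]
      by (simp add: cinner_add_right coeff[OF u])
  next
    fix c v assume "v \<in> H"
    show "(LINT y|m. cinner (?F y u) (cscale c v)) = cnj c * (LINT y|m. cinner (?F y u) v)"
      by (simp add: cinner_cscale_right)
  qed
  then have "\<exists>T. \<forall>u\<in>H. T u \<in> H \<and> (\<forall>v\<in>H. cinner (T u) v = (LINT y|m. cinner (?F y u) v))"
    by metis
  then have "\<forall>u\<in>H. fourier m f (H, \<pi>) u \<in> H \<and>
      (\<forall>v\<in>H. cinner (fourier m f (H, \<pi>) u) v = (LINT y|m. cinner (?F y u) v))"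
    unfolding fourier_def weak_integral_def prod.case by (rule someI_ex)
  then show "fourier m f (H, \<pi>) u \<in> H"
    "v \<in> H \<Longrightarrow> cinner (fourier m f (H, \<pi>) u) v = (LINT y|m. f y * cinner u (\<pi> y v))"
    using u coeff by auto
qed


section \<open>Averages over a compact open subgroup\<close>

text \<open>The matrix coefficients of the adjoint of \<open>\<integral>\<^bsub>K\<^esub> \<pi>(y) dm(y)\<close>, that is, of the Fourier transform
of the indicator of \<open>K\<close>.  Up to the factor \<open>m(K)\<close> it is the projection onto the \<open>K\<close>-fixed vectors.\<close>

definition average_coeff ::
    "'g measure \<Rightarrow> 'g set \<Rightarrow> 'g rep \<Rightarrow> ell2 \<Rightarrow> ell2 \<Rightarrow> complex" where
  "average_coeff m K = (\<lambda>(H, \<pi>) u v. LINT y|m. indicator K y * cinner u (\<pi> y v))"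

definition fixes_vector :: "'g set \<Rightarrow> 'g rep \<Rightarrow> ell2 \<Rightarrow> bool" where
  "fixes_vector K p v \<longleftrightarrow> (\<forall>k\<in>K. snd p k v = v)"

definition has_fixed_vector :: "'g set \<Rightarrow> 'g rep \<Rightarrow> bool" where
  "has_fixed_vector K p \<longleftrightarrow> (\<exists>v\<in>fst p. v \<noteq> 0 \<and> fixes_vector K p v)"

definition acts_trivially :: "'g set \<Rightarrow> 'g rep \<Rightarrow> bool" where
  "acts_trivially K p \<longleftrightarrow> (\<forall>v\<in>fst p. fixes_vector K p v)"

lemma indicator_integrable:
  assumes "haar_measure m" "compact_open_subgroup K"
  shows "integrable m (indicator K :: _ \<Rightarrow> complex)"
  by (rule integrableI_bounded_set[where A = K and B = 1])
    (use compact_open_subgroup_measure[OF assms] in \<open>auto simp: indicator_def\<close>)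

lemma average_coeff_fixed:
  assumes "haar_measure m" "compact_open_subgroup K" "fixes_vector K (H, \<pi>) v"
  shows "average_coeff m K (H, \<pi>) u v = of_real (measure m K) * cinner u v"
proof -
  have "average_coeff m K (H, \<pi>) u v = (LINT y|m. indicator K y * cinner u v)"
    unfolding average_coeff_def prod.case
    by (rule Bochner_Integration.integral_cong)
      (use assms(3) in \<open>auto simp: indicator_def fixes_vector_def\<close>)
  also have "\<dots> = (LINT y|m. complex_of_real (indicator K y)) * cinner u v"
    using indicator_integrable[OF assms(1,2)] by (simp add: of_real_indicator)
  also have "\<dots> = of_real (measure m K) * cinner u v"
    by (simp add: haar_measure_space[OF assms(1)] del: of_real_indicator)
  finally show ?thesis .
qed

text \<open>The vector \<open>q = \<integral>\<^bsub>K\<^esub> \<pi>(y) v dm(y)\<close> is fixed by \<open>K\<close> because Haar measure is left invariant and left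
translation by an element of \<open>K\<close> preserves \<open>K\<close>.\<close>

lemma average_vector:
  assumes m: "haar_measure m" and K: "compact_open_subgroup K" and rep: "unitary_rep (H, \<pi>)"
    and fin: "finite_dim H" and v: "v \<in> H"
  obtains q where "q \<in> H" "fixes_vector K (H, \<pi>) q"
    "\<And>u. u \<in> H \<Longrightarrow> average_coeff m K (H, \<pi>) u v = cinner u q"
proof -
  obtain B where B: "finite_onb H B"
    using finite_onb_exists[OF fin unitary_repD(1)[OF rep]] by blast
  note int = coefficient_integrable[OF m rep v indicator_integrable[OF m K]]
  let ?A = "\<lambda>u. average_coeff m K (H, \<pi>) u v"
  have "\<exists>q\<in>H. \<forall>u\<in>H. cinner q u = cnj (?A u)"
  proof (rule finite_dim_riesz[OF B])
    show "cnj (?A (u + w)) = cnj (?A u) + cnj (?A w)" for u w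
      using int by (simp add: average_coeff_def cinner_add_left_ell2 distrib_left)
    show "cnj (?A (cscale c u)) = cnj c * cnj (?A u)" for c u
      by (simp add: average_coeff_def cinner_cscale_left_ell2 mult.left_commute[of _ c])
  qed
  then obtain q where q: "q \<in> H" "\<And>u. u \<in> H \<Longrightarrow> cinner q u = cnj (?A u)" by blast
  then have qA: "?A u = cinner u q" if "u \<in> H" for u
    using that cinner_commute[of u q] by simp
  have "\<pi> k q = q" if k: "k \<in> K" for k
  proof (rule cinner_ext[OF unitary_repD(4)[OF rep q(1)] q(1) unitary_repD(2)[OF rep]])
    fix u assume u: "u \<in> H"
    have nk: "\<pi> (- k) u \<in> H" using unitary_repD(4)[OF rep u] .
    have [measurable]: "K \<in> sets borel"
      using compact_open_subgroup_measure(1)[OF m K] haar_measure_sets[OF m] by simp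
    have "(\<lambda>y. indicator K y * cinner u (\<pi> y v)) \<in> borel_measurable borel"
      using coefficient_measurable[OF rep v] by measurable
    from haar_integral_translate[OF m this, of k]
    have "?A u = (LINT y|m. indicator K (k + y) * cinner u (\<pi> (k + y) v))"
      by (simp add: average_coeff_def)
    also have "\<dots> = ?A (\<pi> (- k) u)"
    proof -
      have "cinner (\<pi> (- k) u) (\<pi> y v) = cinner u (\<pi> (k + y) v)" for y
        using cinner_rep_left[OF rep u unitary_repD(4)[OF rep v], of "- k" y]
          unitary_repD(8)[OF rep v, of k y] by simp
      moreover have "indicator K (k + y) = (indicator K y :: complex)" for y
        using subgroup_translate_mem_iff[OF K k] by (simp add: indicator_def)
      ultimately show ?thesis by (simp add: average_coeff_def)
    qed
    finally have "cinner u q = cinner (\<pi> (- k) u) q"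
      using qA u nk by simp
    also have "\<dots> = cinner u (\<pi> k q)"
      using cinner_rep_left[OF rep u q(1), of "- k"] by simp
    finally show "cinner (\<pi> k q) u = cinner q u"
      using cinner_commute by metis
  qed
  then show ?thesis
    using that[OF q(1) _ qA] by (simp add: fixes_vector_def)
qed

lemma average_coeff_nonzero_imp_fixed_vector:
  assumes "haar_measure m" "compact_open_subgroup K" "unitary_rep (H, \<pi>)" "finite_dim H"
    "u \<in> H" "v \<in> H" "average_coeff m K (H, \<pi>) u v \<noteq> 0"
  shows "has_fixed_vector K (H, \<pi>)"
proof -
  obtain q where q: "q \<in> H" "fixes_vector K (H, \<pi>) q" "average_coeff m K (H, \<pi>) u v = cinner u q"
    using average_vector[OF assms(1-4,6)] assms(5) by metis
  then have "q \<noteq> 0" using assms(7) by auto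
  then show ?thesis using q by (auto simp: has_fixed_vector_def)
qed

lemma average_coeff_ge:
  assumes m: "haar_measure m" and K: "compact_open_subgroup K" and rep: "unitary_rep (H, \<pi>)"
    and v: "v \<in> H" and ge: "\<And>k. k \<in> K \<Longrightarrow> c \<le> Re (cinner (\<pi> k v) v)"
  shows "c * measure m K \<le> Re (average_coeff m K (H, \<pi>) v v)"
proof -
  have Re_eq: "Re (cinner v (\<pi> k v)) = Re (cinner (\<pi> k v) v)" for k
    by (subst cinner_commute) simp
  note int = coefficient_integrable[OF m rep v indicator_integrable[OF m K], of v]
  have "c * measure m K = (LINT y|m. indicator K y * c)"
    using compact_open_subgroup_measure[OF m K] by (simp add: haar_measure_space[OF m])
  also have "\<dots> \<le> (LINT y|m. Re (indicator K y * cinner v (\<pi> y v)))"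
  proof (rule integral_mono)
    show "integrable m (\<lambda>y. indicator K y * c :: real)"
      using compact_open_subgroup_measure[OF m K]
      by (intro integrable_mult_left) (simp add: integrable_indicator_iff)
    show "integrable m (\<lambda>y. Re (indicator K y * cinner v (\<pi> y v)))"
      using int by (rule integrable_Re)
  qed (auto simp: indicator_def ge Re_eq)
  also have "\<dots> = Re (average_coeff m K (H, \<pi>) v v)"
    unfolding average_coeff_def prod.case by (rule integral_Re[OF int])
  finally show ?thesis .
qed

text \<open>Averaging \<open>v\<close> over \<open>K\<close> produces a fixed vector, and the hypothesis keeps the average away from \<open>0\<close>.\<close>

lemma nearly_fixed_imp_fixed_vector:
  fixes m :: "'g::{topological_group_add, t2_space, second_countable_topology} measure"
    and K :: "'g set"
  assumes "haar_measure m" "compact_open_subgroup K" "unitary_rep (H, \<pi>)" "finite_dim H"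
    "v \<in> H" "v \<noteq> 0" "\<And>k. k \<in> K \<Longrightarrow> (norm v)\<^sup>2 / 2 \<le> Re (cinner (\<pi> k v) v)"
  shows "has_fixed_vector K (H, \<pi>)"
proof (rule average_coeff_nonzero_imp_fixed_vector[OF assms(1-5,5)])
  have "0 < (norm v)\<^sup>2 / 2 * measure m K"
    using assms(6) compact_open_subgroup_measure(3)[OF assms(1,2)] by simp
  then have "0 < Re (average_coeff m K (H, \<pi>) v v)"
    using average_coeff_ge[OF assms(1-3,5,7)] by linarith
  then show "average_coeff m K (H, \<pi>) v v \<noteq> 0" by auto
qed

text \<open>The absence of small subgroups in unitary groups.  Subtracting from \<open>v\<close> its mean over \<open>K\<close> leaves
a vector \<open>w\<close> with mean \<open>0\<close>; but the inner product of \<open>w\<close> with its mean has real part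
at least half of \<open>\<parallel>w\<parallel>\<^sup>2\<close>, so \<open>w = 0\<close>.\<close>

lemma small_displacement_imp_acts_trivially:
  fixes m :: "'g::{topological_group_add, t2_space, second_countable_topology} measure"
    and K :: "'g set"
  assumes m: "haar_measure m" and K: "compact_open_subgroup K" and rep: "unitary_rep (H, \<pi>)"
    and fin: "finite_dim H"
    and small: "\<And>k v. k \<in> K \<Longrightarrow> v \<in> H \<Longrightarrow> norm (\<pi> k v - v) \<le> norm v"
  shows "acts_trivially K (H, \<pi>)"
proof -
  have "fixes_vector K (H, \<pi>) v" if v: "v \<in> H" for v
  proof -
    define M where "M = complex_of_real (measure m K)"
    have M: "M \<noteq> 0" using compact_open_subgroup_measure(3)[OF m K] by (simp add: M_def)
    have sub: "cvec.subspace H" by (rule unitary_repD(2)[OF rep])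
    obtain q where q: "q \<in> H" "fixes_vector K (H, \<pi>) q"
      "\<And>u. u \<in> H \<Longrightarrow> average_coeff m K (H, \<pi>) u v = cinner u q"
      using average_vector[OF m K rep fin v] by metis
    define p where "p = cscale (inverse M) q"
    have p: "p \<in> H" using q(1) sub by (simp add: p_def cvec.subspace_scale)
    have pfix: "fixes_vector K (H, \<pi>) p"
      using q unitary_repD(6)[OF rep q(1)] by (simp add: p_def fixes_vector_def)
    define w where "w = v - p"
    have w: "w \<in> H" using v p sub by (simp add: w_def cvec.subspace_diff)
    have "average_coeff m K (H, \<pi>) w w = average_coeff m K (H, \<pi>) w v - average_coeff m K (H, \<pi>) w p"
      using coefficient_integrable[OF m rep v indicator_integrable[OF m K]]
        coefficient_integrable[OF m rep p indicator_integrable[OF m K]]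
      unfolding average_coeff_def prod.case w_def unitary_rep_diff[OF rep v p]
      by (simp add: cinner_diff_right right_diff_distrib)
    also have "\<dots> = cinner w q - M * cinner w p"
      using q(3)[OF w] average_coeff_fixed[OF m K pfix] by (simp add: M_def)
    also have "\<dots> = 0"
      using M by (simp add: p_def cinner_cscale_right M_def)
    finally have "(norm w)\<^sup>2 / 2 * measure m K \<le> 0"
      using average_coeff_ge[OF m K rep w, of "(norm w)\<^sup>2 / 2"] Re_cinner_rep_ge[OF rep w] small[OF _ w]
      by simp
    then have "w = 0"
      using compact_open_subgroup_measure(3)[OF m K] by (simp add: mult_le_0_iff)
    then show ?thesis using pfix by (simp add: w_def)
  qed
  then show ?thesis by (simp add: acts_trivially_def)
qed

text \<open>The elements that move every vector of an orthonormal basis by little form a neighbourhood of the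
identity component.  A compact open subgroup inside it moves all vectors by little, with a uniform
constant because the dimension is finite.\<close>

lemma acts_trivially_on_nbhd:
  fixes m :: "'g::{topological_group_add, t2_space, second_countable_topology} measure"
  assumes m: "haar_measure m" and lc: "locally_compact_space (euclidean :: 'g topology)"
    and cpt: "compact (identity_component :: 'g set)"
    and rep: "unitary_rep (H, \<pi>)" and fin: "finite_dim H"
    and triv: "acts_trivially (identity_component :: 'g set) (H, \<pi>)"
  shows "\<exists>K. compact_open_subgroup K \<and> acts_trivially K (H, \<pi>)"
proof -
  obtain B where B: "finite_onb H B"
    using finite_onb_exists[OF fin unitary_repD(1)[OF rep]] by blast
  then have finB: "finite B" and BH: "B \<subseteq> H" by (auto simp: finite_onb_def)
  \<comment> \<open>The bound is chosen so that, by expansion in \<open>B\<close>, no vector is moved by more than its norm.\<close>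
  define V where "V = {g. \<forall>e\<in>B. norm (\<pi> g e - e) < 1 / (card B + 1)}"
  have "open V"
  proof -
    have "V = (\<Inter>e\<in>B. {g. norm (\<pi> g e - e) < 1 / (card B + 1)})" by (auto simp: V_def)
    moreover have "open {g. norm (\<pi> g e - e) < 1 / (card B + 1)}" if "e \<in> B" for e
      using that BH by (intro open_Collect_less continuous_intros unitary_repD(9)[OF rep]) auto
    ultimately show ?thesis using finB by auto
  qed
  moreover have "identity_component \<subseteq> V"
    using triv BH by (auto simp: V_def acts_trivially_def fixes_vector_def)
  ultimately obtain K where K: "compact_open_subgroup K" "K \<subseteq> V"
    using compact_open_subgroup_in_nbhd[OF lc cpt] by blast
  have "norm (\<pi> k v - v) \<le> norm v" if "k \<in> K" and v: "v \<in> H" for k v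
  proof -
    have kV: "norm (\<pi> k e - e) \<le> 1 / (card B + 1)" if "e \<in> B" for e
      using \<open>k \<in> K\<close> K(2) that by (auto simp: V_def less_imp_le)
    have exp: "v = (\<Sum>e\<in>B. cscale (cinner v e) e)" by (rule finite_onb_expand[OF B v])
    have "\<pi> k v = (\<Sum>e\<in>B. cscale (cinner v e) (\<pi> k e))"
      using unitary_rep_sum[OF rep finB BH, of k "cinner v"] exp by simp
    then have "\<pi> k v - v = (\<Sum>e\<in>B. cscale (cinner v e) (\<pi> k e - e))"
      using exp by (simp add: cvec.scale_right_diff_distrib sum_subtractf)
    then have "norm (\<pi> k v - v) \<le> (\<Sum>e\<in>B. norm (cscale (cinner v e) (\<pi> k e - e)))"
      by (simp add: norm_sum)
    also have "\<dots> \<le> (\<Sum>e\<in>B. norm v * (1 / (card B + 1)))"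
    proof (rule sum_mono)
      fix e assume e: "e \<in> B"
      have "cmod (cinner v e) \<le> norm v"
        using cmod_cinner_le[of v e] finite_onb_norm1[OF B e] by simp
      then show "norm (cscale (cinner v e) (\<pi> k e - e)) \<le> norm v * (1 / (card B + 1))"
        unfolding norm_cscale using kV[OF e] by (intro mult_mono) auto
    qed
    also have "\<dots> \<le> norm v" by (simp add: field_simps)
    finally show ?thesis .
  qed
  then show ?thesis
    using small_displacement_imp_acts_trivially[OF m K(1) rep fin] K(1) by blast
qed

text \<open>The fixed vectors of a normal subgroup form a closed invariant subspace.\<close>

lemma irreducible_fixed_vector_imp_acts_trivially:
  assumes irr: "irreducible_rep (H, \<pi>)"
    and N: "\<And>x y. y \<in> N \<Longrightarrow> - x + y + x \<in> N"
    and fixed: "has_fixed_vector N (H, \<pi>)"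
  shows "acts_trivially N (H, \<pi>)"
proof -
  have rep: "unitary_rep (H, \<pi>)" using irr by (simp add: irreducible_rep_def)
  note sub = unitary_repD(2)[OF rep]
  define K where "K = {v\<in>H. fixes_vector N (H, \<pi>) v}"
  have "cvec.subspace K"
    using sub unitary_repD(5,6)[OF rep] unitary_rep_diff[OF rep, of 0 0]
    by (auto simp: K_def cvec.subspace_def fixes_vector_def)
  moreover have "closed K"
  proof -
    have "closed {v\<in>H. \<pi> k v - v = 0}" for k
    proof (rule continuous_closed_preimage_constant)
      have "continuous_on H (\<pi> k)"
        unfolding continuous_on_iff
        using unitary_rep_norm[OF rep] unitary_rep_diff[OF rep] cvec.subspace_diff[OF sub]
        by (metis dist_norm)
      then show "continuous_on H (\<lambda>v. \<pi> k v - v)" by (intro continuous_intros)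
    qed (rule unitary_repD(3)[OF rep])
    then have "closed (H \<inter> (\<Inter>k\<in>N. {v\<in>H. \<pi> k v - v = 0}))"
      using unitary_repD(3)[OF rep] by (intro closed_Int closed_INT) auto
    moreover have "K = H \<inter> (\<Inter>k\<in>N. {v\<in>H. \<pi> k v - v = 0})"
      by (auto simp: K_def fixes_vector_def)
    ultimately show ?thesis by simp
  qed
  moreover have "\<pi> x ` K \<subseteq> K" for x
  proof (clarsimp simp: K_def fixes_vector_def unitary_repD(4)[OF rep])
    fix v k assume v: "v \<in> H" "\<forall>k\<in>N. \<pi> k v = v" and k: "k \<in> N"
    have "\<pi> k (\<pi> x v) = \<pi> (x + (- x + k + x)) v"
      by (simp add: unitary_repD(8)[OF rep v(1), symmetric] add.assoc)
    also have "\<dots> = \<pi> x v"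
      unfolding unitary_repD(8)[OF rep v(1), of x "- x + k + x"] using v(2) N[OF k] by simp
    finally show "\<pi> k (\<pi> x v) = \<pi> x v" .
  qed
  moreover have "K \<noteq> {0}" using fixed by (auto simp: K_def has_fixed_vector_def)
  moreover have "K \<subseteq> H" by (auto simp: K_def)
  ultimately have "K = H"
    using irr unfolding irreducible_rep_def closed_csubspace_def prod.case by blast
  then show ?thesis by (auto simp: K_def acts_trivially_def)
qed


section \<open>Measurable sets of irreducible representations\<close>

lemma class_rep_equiv:
  assumes "irreducible_rep p"
  shows "(p, class_rep (rep_equiv `` {p})) \<in> rep_equiv"
proof -
  obtain H \<pi> where p: "p = (H, \<pi>)" by (cases p)
  have id: "unitary_between H H (\<lambda>v. v)"
    by (simp add: unitary_between_def bij_betw_def)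
  have "(p, p) \<in> rep_equiv"
    using assms unfolding p rep_equiv_def mem_Collect_eq prod.case
    by (intro conjI exI[of _ "\<lambda>v. v"] id) simp_all
  then have "p \<in> rep_equiv `` {p}" by simp
  then have "class_rep (rep_equiv `` {p}) \<in> rep_equiv `` {p}"
    unfolding class_rep_def by (rule someI)
  then show ?thesis by simp
qed

lemma class_in_unitary_dual: "irreducible_rep p \<Longrightarrow> rep_equiv `` {p} \<in> unitary_dual"
  unfolding unitary_dual_def by (rule quotientI) simp

lemma irreducible_class_rep:
  assumes "c \<in> unitary_dual"
  shows "irreducible_rep (class_rep c)"
proof -
  obtain p where "irreducible_rep p" "c = rep_equiv `` {p}"
    using assms by (auto simp: unitary_dual_def quotient_def)
  then show ?thesis
    using class_rep_equiv[of p] by (auto simp: rep_equiv_def)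
qed

text \<open>The properties of representations used below concern only which vectors are fixed by which
group elements, and an intertwining unitary transports these.\<close>

lemma rep_equiv_fixes_vector:
  assumes "((H, \<pi>), (K, \<rho>)) \<in> rep_equiv"
  obtains U where "U ` H = K" "\<And>v. v \<in> H \<Longrightarrow> U v = 0 \<longleftrightarrow> v = 0"
    "\<And>N v. v \<in> H \<Longrightarrow> fixes_vector N (K, \<rho>) (U v) \<longleftrightarrow> fixes_vector N (H, \<pi>) v"
proof -
  obtain U where U: "unitary_between H K U" "\<And>x v. v \<in> H \<Longrightarrow> U (\<pi> x v) = \<rho> x (U v)"
    using assms by (auto simp: rep_equiv_def)
  have rep: "unitary_rep (H, \<pi>)"
    using assms by (simp add: rep_equiv_def irreducible_rep_def)
  have bij: "bij_betw U H K" using U(1) by (simp add: unitary_between_def)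
  show ?thesis
  proof
    show "U ` H = K" using bij by (simp add: bij_betw_def)
  next
    fix v assume v: "v \<in> H"
    have "cinner (U v) (U v) = cinner v v" using U(1) v by (simp add: unitary_between_def)
    then show "U v = 0 \<longleftrightarrow> v = 0" by (metis cinner_eq_zero_iff)
    fix N
    have "\<rho> x (U v) = U v \<longleftrightarrow> \<pi> x v = v" for x
      using bij U(2)[OF v, of x] v unitary_repD(4)[OF rep v, of x]
      by (auto simp: bij_betw_def inj_on_def)
    then show "fixes_vector N (K, \<rho>) (U v) \<longleftrightarrow> fixes_vector N (H, \<pi>) v"
      by (simp add: fixes_vector_def)
  qed
qed

lemma rep_equiv_has_fixed_vector:
  assumes "(p, q) \<in> rep_equiv"
  shows "has_fixed_vector N p \<longleftrightarrow> has_fixed_vector N q"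
proof -
  obtain H \<pi> K \<rho> where pq: "p = (H, \<pi>)" "q = (K, \<rho>)" by (metis surj_pair)
  obtain U where U: "U ` H = K" "\<And>v. v \<in> H \<Longrightarrow> U v = 0 \<longleftrightarrow> v = 0"
    "\<And>N v. v \<in> H \<Longrightarrow> fixes_vector N (K, \<rho>) (U v) \<longleftrightarrow> fixes_vector N (H, \<pi>) v"
    using rep_equiv_fixes_vector assms unfolding pq by metis
  have "(\<exists>w\<in>K. Q w) \<longleftrightarrow> (\<exists>v\<in>H. Q (U v))" for Q using U(1) by blast
  then show ?thesis unfolding pq has_fixed_vector_def fst_conv using U(2,3) by auto
qed

lemma rep_equiv_acts_trivially:
  assumes "(p, q) \<in> rep_equiv"
  shows "acts_trivially N p \<longleftrightarrow> acts_trivially N q"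
proof -
  obtain H \<pi> K \<rho> where pq: "p = (H, \<pi>)" "q = (K, \<rho>)" by (metis surj_pair)
  obtain U where U: "U ` H = K"
    "\<And>N v. v \<in> H \<Longrightarrow> fixes_vector N (K, \<rho>) (U v) \<longleftrightarrow> fixes_vector N (H, \<pi>) v"
    using rep_equiv_fixes_vector assms unfolding pq by metis
  have "(\<forall>w\<in>K. Q w) \<longleftrightarrow> (\<forall>v\<in>H. Q (U v))" for Q using U(1) by blast
  then show ?thesis unfolding pq acts_trivially_def fst_conv using U(2) by auto
qed

text \<open>Reduces measurability on the dual, where points are equivalence classes with chosen
representatives, to measurability on each space of concrete irreducible representations.\<close>

lemma dual_borel_Collect:
  assumes inv: "\<And>p q. (p, q) \<in> rep_equiv \<Longrightarrow> P p \<longleftrightarrow> P q"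
    and meas: "\<And>H. {\<pi> \<in> irr_on H. P (H, \<pi>)} \<in> sets (irr_borel H)"
  shows "{c \<in> unitary_dual. P (class_rep c)} \<in> sets dual_borel"
proof -
  have "{\<pi> \<in> irr_on H. rep_equiv `` {(H, \<pi>)} \<in> {c \<in> unitary_dual. P (class_rep c)}}
      = {\<pi> \<in> irr_on H. P (H, \<pi>)}" for H
    using class_in_unitary_dual inv[OF class_rep_equiv] by (auto simp: irr_on_def)
  then show ?thesis
    unfolding dual_borel_def using meas
    by (subst sets_measure_of) (auto intro!: sigma_sets.Basic)
qed

lemma space_irr_borel: "space (irr_borel H) = irr_on H"
  unfolding irr_borel_def by (rule space_measure_of_conv)

lemma coefficient_measurable_irr:
  assumes "u \<in> H" "v \<in> H"
  shows "(\<lambda>\<pi>. cinner (\<pi> x u) v) \<in> borel_measurable (irr_borel H)"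
proof (rule measurableI)
  fix B :: "complex set" assume B: "B \<in> sets borel"
  have "{\<pi> \<in> irr_on H. cinner (\<pi> x u) v \<in> B} \<in> sets (irr_borel H)"
    unfolding irr_borel_def using assms B
    by (subst sets_measure_of) (auto intro!: sigma_sets.Basic)
  moreover have "(\<lambda>\<pi>. cinner (\<pi> x u) v) -` B \<inter> space (irr_borel H)
      = {\<pi> \<in> irr_on H. cinner (\<pi> x u) v \<in> B}"
    by (auto simp: space_irr_borel)
  ultimately show "(\<lambda>\<pi>. cinner (\<pi> x u) v) -` B \<inter> space (irr_borel H) \<in> sets (irr_borel H)"
    by simp
qed simp

lemma open_subset_closed_if_dense:
  assumes "\<And>X. open X \<Longrightarrow> X \<noteq> {} \<Longrightarrow> \<exists>d\<in>E. d \<in> X" "open K" "closed C" "K \<inter> E \<subseteq> C"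
  shows "K \<subseteq> C"
  using assms(1)[of "K - C"] assms(2-4) by (auto simp: open_Diff)

text \<open>Having a \<open>K\<close>-fixed vector is equivalent to having a nonzero vector \<open>u\<close> that \<open>K\<close> displaces by
little.  The second condition is stable under small perturbations of \<open>u\<close> and closed in the group
element, so \<open>u\<close> may range over a countable dense set of vectors and the group element over a countable
dense subset of \<open>K\<close>.  The criterion avoids the integral over \<open>K\<close>, whose
dependence on the representation is not visibly measurable.\<close>

lemma sets_has_fixed_vector:
  fixes m :: "'g::{topological_group_add, t2_space, second_countable_topology} measure"
    and K :: "'g set"
  assumes m: "haar_measure m" and K: "compact_open_subgroup K"
    and fin: "\<And>\<pi> :: 'g \<Rightarrow> ell2 \<Rightarrow> ell2. irreducible_rep (H, \<pi>) \<Longrightarrow> finite_dim H"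
  shows "{\<pi> \<in> irr_on H. has_fixed_vector K (H, \<pi>)} \<in> sets (irr_borel H)"
proof (cases "irr_on H = ({} :: ('g \<Rightarrow> ell2 \<Rightarrow> ell2) set)")
  case False
  then obtain \<pi>0 :: "'g \<Rightarrow> ell2 \<Rightarrow> ell2" where "irreducible_rep (H, \<pi>0)"
    by (auto simp: irr_on_def)
  then have H: "finite_dim H" "closed_csubspace H"
    using fin by (auto simp: irreducible_rep_def unitary_rep_def)
  obtain B where B: "finite_onb H B" using finite_onb_exists[OF H] by blast
  obtain D where D: "countable D" "D \<subseteq> H"
    "\<And>v r. v \<in> H \<Longrightarrow> 0 < r \<Longrightarrow> \<exists>u\<in>D. norm (u - v) < r"
    using countable_dense_in_finite_dim[OF B] by metis
  obtain E :: "'g set" where E: "countable E" "\<And>X. open X \<Longrightarrow> X \<noteq> {} \<Longrightarrow> \<exists>d\<in>E. d \<in> X"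
    by (rule countable_dense_setE) blast
  have iff: "has_fixed_vector K (H, \<pi>) \<longleftrightarrow>
      (\<exists>u\<in>D - {0}. \<forall>k\<in>K \<inter> E. (norm u)\<^sup>2 / 2 \<le> Re (cinner (\<pi> k u) u))"
    (is "_ \<longleftrightarrow> ?R \<pi>") if "\<pi> \<in> irr_on H" for \<pi>
  proof
    have rep: "unitary_rep (H, \<pi>)" using that by (simp add: irr_on_def irreducible_rep_def)
    assume "has_fixed_vector K (H, \<pi>)"
    then obtain v where v: "v \<in> H" "v \<noteq> 0" "\<And>k. k \<in> K \<Longrightarrow> \<pi> k v = v"
      by (auto simp: has_fixed_vector_def fixes_vector_def)
    \<comment> \<open>Moving \<open>u\<close> costs at most \<open>2 \<parallel>u - v\<parallel> < 2/3 \<parallel>v\<parallel> < \<parallel>u\<parallel>\<close>; this dictates the fraction \<open>1/3\<close>.\<close>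
    obtain u where u: "u \<in> D" "norm (u - v) < norm v / 3"
      using D(3)[OF v(1), of "norm v / 3"] v(2) by auto
    have uH: "u \<in> H" using u(1) D(2) by blast
    have nu: "norm v - norm v / 3 < norm u"
      using norm_triangle_ineq2[of v u] u(2) by (simp add: norm_minus_commute)
    have "(norm u)\<^sup>2 / 2 \<le> Re (cinner (\<pi> k u) u)" if k: "k \<in> K" for k
    proof (rule Re_cinner_rep_ge[OF rep uH])
      have "u - v \<in> H" using uH v(1) cvec.subspace_diff[OF unitary_repD(2)[OF rep]] by blast
      then have iso: "norm (\<pi> k (u - v)) = norm (u - v)" by (rule unitary_rep_norm[OF rep])
      have eq: "\<pi> k u - u = \<pi> k (u - v) - (u - v)"
        using unitary_rep_diff[OF rep uH v(1), of k] v(3)[OF k] by simp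
      have "norm (\<pi> k u - u) \<le> 2 * norm (u - v)"
        unfolding eq using norm_triangle_ineq4[of "\<pi> k (u - v)" "u - v"] iso by simp
      then show "norm (\<pi> k u - u) \<le> norm u" using u(2) nu by linarith
    qed
    moreover have "u \<noteq> 0" using nu v(2) by auto
    ultimately show "?R \<pi>" using u(1) by (intro bexI[of _ u]) auto
  next
    have rep: "unitary_rep (H, \<pi>)" using that by (simp add: irr_on_def irreducible_rep_def)
    assume "?R \<pi>"
    then obtain u where u: "u \<in> H" "u \<noteq> 0"
      "\<And>k. k \<in> K \<inter> E \<Longrightarrow> (norm u)\<^sup>2 / 2 \<le> Re (cinner (\<pi> k u) u)"
      using D(2) by blast
    have "K \<subseteq> {k. (norm u)\<^sup>2 / 2 \<le> Re (cinner (\<pi> k u) u)}"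
    proof (rule open_subset_closed_if_dense[OF E(2) compact_open_subgroupD(2)[OF K]])
      show "closed {k. (norm u)\<^sup>2 / 2 \<le> Re (cinner (\<pi> k u) u)}"
        by (intro closed_Collect_le continuous_intros unitary_repD(9)[OF rep u(1)])
    qed (use u(3) in auto)
    then show "has_fixed_vector K (H, \<pi>)"
      using nearly_fixed_imp_fixed_vector[OF m K rep H(1) u(1,2)] by blast
  qed
  have "{\<pi> \<in> space (irr_borel H). ?R \<pi>} \<in> sets (irr_borel H)"
  proof (intro sets.sets_Collect_countable_Ex' sets.sets_Collect_countable_All')
    fix u k assume "u \<in> D - {0}"
    then have "u \<in> H" using D(2) by blast
    then have [measurable]: "(\<lambda>\<pi>. cinner (\<pi> k u) u) \<in> borel_measurable (irr_borel H)"
      by (intro coefficient_measurable_irr)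
    show "{\<pi> \<in> space (irr_borel H). (norm u)\<^sup>2 / 2 \<le> Re (cinner (\<pi> k u) u)} \<in> sets (irr_borel H)"
      by measurable
  qed (use D(1) E(1) in auto)
  moreover have "{\<pi> \<in> space (irr_borel H). ?R \<pi>} = {\<pi> \<in> irr_on H. has_fixed_vector K (H, \<pi>)}"
    using iff by (auto simp: space_irr_borel)
  ultimately show ?thesis by simp
qed simp

text \<open>Expresses triviality through finitely many matrix coefficients.\<close>

lemma acts_trivially_singleton_iff:
  assumes rep: "unitary_rep (H, \<pi>)" and B: "finite_onb H B"
  shows "acts_trivially {x} (H, \<pi>) \<longleftrightarrow> (\<forall>e\<in>B. \<forall>e'\<in>B. cinner (\<pi> x e) e' = cinner e e')"
proof
  assume R: "\<forall>e\<in>B. \<forall>e'\<in>B. cinner (\<pi> x e) e' = cinner e e'"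
  have fB: "finite B" and BH: "B \<subseteq> H" using B by (auto simp: finite_onb_def)
  have e: "\<pi> x e = e" if e: "e \<in> B" for e
  proof -
    have "\<pi> x e = (\<Sum>e'\<in>B. cscale (cinner (\<pi> x e) e') e')"
      using finite_onb_expand[OF B] unitary_repD(4)[OF rep] e BH by blast
    also have "\<dots> = (\<Sum>e'\<in>B. cscale (cinner e e') e')"
      using R e by (intro sum.cong) auto
    also have "\<dots> = e" using finite_onb_expand[OF B, of e] e BH by auto
    finally show ?thesis .
  qed
  have "\<pi> x v = v" if v: "v \<in> H" for v
  proof -
    have "\<pi> x v = (\<Sum>e\<in>B. cscale (cinner v e) (\<pi> x e))"
      using unitary_rep_sum[OF rep fB BH, of x "cinner v"] finite_onb_expand[OF B v] by simp
    also have "\<dots> = v" using e finite_onb_expand[OF B v] by simp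
    finally show ?thesis .
  qed
  then show "acts_trivially {x} (H, \<pi>)" by (simp add: acts_trivially_def fixes_vector_def)
qed (use B in \<open>auto simp: acts_trivially_def fixes_vector_def finite_onb_def subset_iff\<close>)

lemma sets_acts_trivially:
  fixes K :: "'g::{topological_group_add, t2_space, second_countable_topology} set"
  assumes "open K"
    and fin: "\<And>\<pi> :: 'g \<Rightarrow> ell2 \<Rightarrow> ell2. irreducible_rep (H, \<pi>) \<Longrightarrow> finite_dim H"
  shows "{\<pi> \<in> irr_on H. acts_trivially K (H, \<pi>) \<and> \<not> acts_trivially {x} (H, \<pi>)} \<in> sets (irr_borel H)"
proof (cases "irr_on H = ({} :: ('g \<Rightarrow> ell2 \<Rightarrow> ell2) set)")
  case False
  then obtain \<pi>0 :: "'g \<Rightarrow> ell2 \<Rightarrow> ell2" where "irreducible_rep (H, \<pi>0)"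
    by (auto simp: irr_on_def)
  then have H: "finite_dim H" "closed_csubspace H"
    using fin by (auto simp: irreducible_rep_def unitary_rep_def)
  obtain B where B: "finite_onb H B" using finite_onb_exists[OF H] by blast
  then have fB: "finite B" "B \<subseteq> H" by (auto simp: finite_onb_def)
  obtain E :: "'g set" where E: "countable E" "\<And>X. open X \<Longrightarrow> X \<noteq> {} \<Longrightarrow> \<exists>d\<in>E. d \<in> X"
    by (rule countable_dense_setE) blast
  have single: "{\<pi> \<in> irr_on H. acts_trivially {k} (H, \<pi>)} \<in> sets (irr_borel H)" for k :: 'g
  proof -
    have "{\<pi> \<in> space (irr_borel H). \<forall>e\<in>B. \<forall>e'\<in>B. cinner (\<pi> k e) e' = cinner e e'}
        \<in> sets (irr_borel H)"
    proof (intro sets.sets_Collect_finite_All)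
      fix e e' assume "e \<in> B" "e' \<in> B"
      then have [measurable]: "(\<lambda>\<pi>. cinner (\<pi> k e) e') \<in> borel_measurable (irr_borel H)"
        using fB by (intro coefficient_measurable_irr) auto
      show "{\<pi> \<in> space (irr_borel H). cinner (\<pi> k e) e' = cinner e e'} \<in> sets (irr_borel H)"
        by measurable
    qed (use fB in auto)
    moreover have "{\<pi> \<in> irr_on H. acts_trivially {k} (H, \<pi>)} =
        {\<pi> \<in> space (irr_borel H). \<forall>e\<in>B. \<forall>e'\<in>B. cinner (\<pi> k e) e' = cinner e e'}"
      using acts_trivially_singleton_iff[OF _ B]
      by (auto simp: space_irr_borel irr_on_def irreducible_rep_def)
    ultimately show ?thesis by simp
  qed
  have iff: "acts_trivially K (H, \<pi>) \<longleftrightarrow> (\<forall>k\<in>K \<inter> E. acts_trivially {k} (H, \<pi>))"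
    if "\<pi> \<in> irr_on H" for \<pi>
  proof
    have rep: "unitary_rep (H, \<pi>)" using that by (simp add: irr_on_def irreducible_rep_def)
    assume R: "\<forall>k\<in>K \<inter> E. acts_trivially {k} (H, \<pi>)"
    have "K \<subseteq> {k. \<pi> k v = v}" if v: "v \<in> H" for v
    proof (rule open_subset_closed_if_dense[OF E(2) assms(1)])
      show "closed {k. \<pi> k v = v}"
        by (intro closed_Collect_eq continuous_intros unitary_repD(9)[OF rep v])
    qed (use R v in \<open>auto simp: acts_trivially_def fixes_vector_def\<close>)
    then show "acts_trivially K (H, \<pi>)" by (auto simp: acts_trivially_def fixes_vector_def)
  qed (auto simp: acts_trivially_def fixes_vector_def)
  have "{\<pi> \<in> space (irr_borel H). (\<forall>k\<in>K \<inter> E. acts_trivially {k} (H, \<pi>)) \<and> \<not> acts_trivially {x} (H, \<pi>)}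
      \<in> sets (irr_borel H)"
    by (intro sets.sets_Collect_conj sets.sets_Collect_neg sets.sets_Collect_countable_All')
      (use single E(1) in \<open>auto simp: space_irr_borel\<close>)
  moreover have "{\<pi> \<in> space (irr_borel H). (\<forall>k\<in>K \<inter> E. acts_trivially {k} (H, \<pi>)) \<and> \<not> acts_trivially {x} (H, \<pi>)}
      = {\<pi> \<in> irr_on H. acts_trivially K (H, \<pi>) \<and> \<not> acts_trivially {x} (H, \<pi>)}"
    using iff by (auto simp: space_irr_borel)
  ultimately show ?thesis by simp
qed simp


section \<open>Hilbert--Schmidt norms\<close>

lemma fourier_indicator_coefficient:
  assumes "haar_measure m" "compact_open_subgroup K" "unitary_rep (H, \<pi>)" "finite_dim H" "u \<in> H" "v \<in> H"
  shows "cinner (fourier m (indicator K) (H, \<pi>) u) v = average_coeff m K (H, \<pi>) u v"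
  using fourier_coefficient(2)[OF assms(1,3,4) indicator_integrable[OF assms(1,2)] assms(5,6)]
  by (simp add: average_coeff_def)

text \<open>The adjoint of the Fourier transform of the indicator of \<open>K\<close> multiplies a fixed vector \<open>v\<close> by
\<open>m(K)\<close>; Cauchy--Schwarz for each basis vector and Parseval for \<open>v\<close> give the bound.\<close>

lemma hs_norm_fourier_indicator_ge:
  assumes m: "haar_measure m" and K: "compact_open_subgroup K" and rep: "unitary_rep (H, \<pi>)"
    and fin: "finite_dim H" and fixed: "has_fixed_vector K (H, \<pi>)"
  shows "ennreal ((measure m K)\<^sup>2) \<le> hs_norm_sq H (fourier m (indicator K) (H, \<pi>))"
proof -
  let ?T = "fourier m (indicator K) (H, \<pi>)"
  let ?M = "measure m K"
  obtain B where B: "finite_onb H B" "hs_norm_sq H ?T = (\<Sum>e\<in>B. ennreal ((norm (?T e))\<^sup>2))"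
    using hs_norm_sq_onb[OF fin unitary_repD(1)[OF rep]] by metis
  then have BH: "B \<subseteq> H" by (auto simp: finite_onb_def)
  obtain v where v: "v \<in> H" "v \<noteq> 0" "fixes_vector K (H, \<pi>) v"
    using fixed by (auto simp: has_fixed_vector_def)
  have "?M\<^sup>2 * (cmod (cinner e v))\<^sup>2 \<le> (norm (?T e))\<^sup>2 * (norm v)\<^sup>2" if "e \<in> B" for e
  proof -
    have "cinner (?T e) v = of_real ?M * cinner e v"
      using fourier_indicator_coefficient[OF m K rep fin _ v(1)] average_coeff_fixed[OF m K v(3)] that BH
      by auto
    then have "?M * cmod (cinner e v) = cmod (cinner (?T e) v)" by (simp add: norm_mult)
    also have "\<dots> \<le> norm (?T e) * norm v" by (rule cmod_cinner_le)
    finally have "(?M * cmod (cinner e v))\<^sup>2 \<le> (norm (?T e) * norm v)\<^sup>2"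
      by (intro power_mono) auto
    then show ?thesis by (simp add: power_mult_distrib)
  qed
  then have "?M\<^sup>2 * (\<Sum>e\<in>B. (cmod (cinner e v))\<^sup>2) \<le> (\<Sum>e\<in>B. (norm (?T e))\<^sup>2) * (norm v)\<^sup>2"
    unfolding sum_distrib_left sum_distrib_right by (rule sum_mono)
  then have "?M\<^sup>2 \<le> (\<Sum>e\<in>B. (norm (?T e))\<^sup>2)"
    using v(2) by (simp add: parseval[OF B(1) v(1)])
  then show ?thesis unfolding B(2) by (simp add: ennreal_leI)
qed

lemma one_dimensional_commutator_acts_trivially:
  assumes rep: "unitary_rep (H, \<pi>)" and onb: "finite_onb H {e}"
  shows "acts_trivially {(a + b) + - (b + a)} (H, \<pi>)"
proof -
  have e: "e \<in> H" using onb by (auto simp: finite_onb_def)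
  have scalar: "\<pi> x v = cscale (cinner (\<pi> x e) e) v" if v: "v \<in> H" for x v
  proof -
    have ve: "v = cscale (cinner v e) e" using finite_onb_expand[OF onb v] by simp
    have xe: "\<pi> x e = cscale (cinner (\<pi> x e) e) e"
      using finite_onb_expand[OF onb unitary_repD(4)[OF rep e], of x] by simp
    have "\<pi> x v = cscale (cinner v e) (\<pi> x e)"
      using unitary_repD(6)[OF rep e] ve by metis
    then show ?thesis
      using ve xe by (metis cvec.scale_left_commute)
  qed
  have comm: "\<pi> (a + b) v = \<pi> (b + a) v" if v: "v \<in> H" for v
    unfolding unitary_repD(8)[OF rep v, of a b] unitary_repD(8)[OF rep v, of b a]
      scalar[OF unitary_repD(4)[OF rep v]]
    unfolding scalar[OF v] by (simp add: mult.commute)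
  have "\<pi> ((a + b) + - (b + a)) v = v" if v: "v \<in> H" for v
    using comm[OF unitary_repD(4)[OF rep v], of "- (b + a)"] unitary_repD(8)[OF rep v, of "a + b" "- (b + a)"]
      unitary_rep_inverse(1)[OF rep v, of "b + a"] by simp
  then show ?thesis by (simp add: acts_trivially_def fixes_vector_def)
qed

text \<open>Here the Fourier transform of the indicator of \<open>K\<close> is the scalar \<open>m(K)\<close>, so its squared norm is
\<open>m(K)\<^sup>2\<close> times the dimension; a commutator that acts nontrivially excludes dimension one.\<close>

lemma hs_norm_fourier_indicator_ge_two:
  assumes m: "haar_measure m" and K: "compact_open_subgroup K" and irr: "irreducible_rep (H, \<pi>)"
    and fin: "finite_dim H" and triv: "acts_trivially K (H, \<pi>)"
    and nontriv: "\<not> acts_trivially {(a + b) + - (b + a)} (H, \<pi>)"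
  shows "2 * ennreal ((measure m K)\<^sup>2) \<le> hs_norm_sq H (fourier m (indicator K) (H, \<pi>))"
proof -
  let ?T = "fourier m (indicator K) (H, \<pi>)"
  let ?M = "measure m K"
  have rep: "unitary_rep (H, \<pi>)" using irr by (simp add: irreducible_rep_def)
  obtain B where B: "finite_onb H B" "hs_norm_sq H ?T = (\<Sum>e\<in>B. ennreal ((norm (?T e))\<^sup>2))"
    using hs_norm_sq_onb[OF fin unitary_repD(1)[OF rep]] by metis
  then have fB: "finite B" and BH: "B \<subseteq> H" and sub: "cvec.subspace H" by (auto simp: finite_onb_def)
  have T: "(norm (?T e))\<^sup>2 = ?M\<^sup>2" if e: "e \<in> B" for e
  proof -
    have eH: "e \<in> H" using e BH by blast
    have "?T e = cscale (of_real ?M) e"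
    proof (rule cinner_ext[OF _ _ sub])
      show "?T e \<in> H"
        by (rule fourier_coefficient(1)[OF m rep fin indicator_integrable[OF m K] eH])
      show "cscale (of_real ?M) e \<in> H" using sub eH by (rule cvec.subspace_scale)
      fix w assume w: "w \<in> H"
      then have "fixes_vector K (H, \<pi>) w" using triv by (simp add: acts_trivially_def)
      then show "cinner (?T e) w = cinner (cscale (of_real ?M) e) w"
        using fourier_indicator_coefficient[OF m K rep fin eH w] average_coeff_fixed[OF m K]
        by (simp add: cinner_cscale_left_ell2)
    qed
    then show ?thesis by (simp add: norm_cscale finite_onb_norm1[OF B(1) e])
  qed
  have "B \<noteq> {}"
  proof
    assume "B = {}"
    then have "H \<subseteq> {0}" using finite_onb_expand[OF B(1)] by auto
    then show False
      using irr cvec.subspace_0[OF sub] by (auto simp: irreducible_rep_def)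
  qed
  moreover have "\<And>e. B \<noteq> {e}"
    using one_dimensional_commutator_acts_trivially[OF rep] B(1) nontriv by blast
  ultimately have "card B \<noteq> 0" "card B \<noteq> 1"
    using fB by (auto simp: card_1_singleton_iff)
  then have "2 \<le> card B" by linarith
  have "2 * ennreal (?M\<^sup>2) \<le> of_nat (card B) * ennreal (?M\<^sup>2)"
    using of_nat_mono[OF \<open>2 \<le> card B\<close>, where 'a = ennreal] by (intro mult_right_mono) simp_all
  also have "\<dots> = (\<Sum>e\<in>B. ennreal ((norm (?T e))\<^sup>2))" by (simp add: T)
  finally show ?thesis unfolding B(2) .
qed


section \<open>The Gabor transform of the indicator of a compact open subgroup\<close>

lemma moore_group_finite_dim:
  fixes \<pi> :: "'g::{topological_group_add, t2_space, second_countable_topology} \<Rightarrow> ell2 \<Rightarrow> ell2"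
  shows "moore_group TYPE('g) \<Longrightarrow> irreducible_rep (H, \<pi>) \<Longrightarrow> finite_dim H"
  by (auto simp: moore_group_def)

lemma gabor_eq_fourier: "gabor m \<psi> f x p = fourier m (\<lambda>y. f y * cnj (\<psi> (- x + y))) p"
  by (cases p) (simp add: gabor_def fourier_def)

lemma fourier_zero:
  assumes "haar_measure m" "unitary_rep (H, \<pi>)" "finite_dim H" "u \<in> H"
  shows "fourier m (\<lambda>_. 0) (H, \<pi>) u = 0"
proof (rule cinner_ext[OF _ _ unitary_repD(2)[OF assms(2)]])
  note co = fourier_coefficient[OF assms(1-3) integrable_zero assms(4)]
  show "fourier m (\<lambda>_. 0) (H, \<pi>) u \<in> H" by (rule co(1))
  show "0 \<in> H" by (rule closed_csubspace_zero_mem[OF unitary_repD(1)[OF assms(2)]])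
  show "cinner (fourier m (\<lambda>_. 0) (H, \<pi>) u) w = cinner 0 w" if "w \<in> H" for w
    using co(2)[OF that] by simp
qed

lemma fourier_indicator_nonzero_iff:
  assumes "haar_measure m" "compact_open_subgroup K" "unitary_rep (H, \<pi>)" "finite_dim H"
  shows "(\<exists>u\<in>H. fourier m (indicator K) (H, \<pi>) u \<noteq> 0) \<longleftrightarrow> has_fixed_vector K (H, \<pi>)"
proof
  assume "\<exists>u\<in>H. fourier m (indicator K) (H, \<pi>) u \<noteq> 0"
  then obtain u where u: "u \<in> H" "fourier m (indicator K) (H, \<pi>) u \<noteq> 0" by blast
  let ?v = "fourier m (indicator K) (H, \<pi>) u"
  have v: "?v \<in> H"
    by (rule fourier_coefficient(1)[OF assms(1,3,4) indicator_integrable[OF assms(1,2)] u(1)])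
  have "average_coeff m K (H, \<pi>) u ?v \<noteq> 0"
    using fourier_indicator_coefficient[OF assms u(1) v] u(2) by (metis cinner_eq_zero_iff)
  then show "has_fixed_vector K (H, \<pi>)"
    by (rule average_coeff_nonzero_imp_fixed_vector[OF assms u(1) v])
next
  assume "has_fixed_vector K (H, \<pi>)"
  then obtain v where v: "v \<in> H" "v \<noteq> 0" "fixes_vector K (H, \<pi>) v"
    by (auto simp: has_fixed_vector_def)
  have "cinner (fourier m (indicator K) (H, \<pi>) v) v = of_real (measure m K) * cinner v v"
    using fourier_indicator_coefficient[OF assms v(1,1)] average_coeff_fixed[OF assms(1,2) v(3)] by simp
  also have "\<dots> \<noteq> 0"
    using v(2) compact_open_subgroup_measure(3)[OF assms(1,2)] by (simp add: cinner_self)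
  finally show "\<exists>u\<in>H. fourier m (indicator K) (H, \<pi>) u \<noteq> 0"
    using v(1) by (intro bexI[of _ v]) auto
qed

definition fixed_dual :: "'g::topological_group_add set \<Rightarrow> 'g rep set set" where
  "fixed_dual K = {c \<in> unitary_dual. has_fixed_vector K (class_rep c)}"

text \<open>For a subgroup, \<open>K\<close> and \<open>x + K\<close> coincide if \<open>x \<in> K\<close> and are disjoint otherwise, so the
windowed signal is \<open>1\<^sub>K\<close> or \<open>0\<close>.\<close>

lemma gabor_support_indicator:
  fixes m :: "'g::{topological_group_add, t2_space, second_countable_topology} measure"
  assumes moore: "moore_group TYPE('g)" and m: "haar_measure m" and K: "compact_open_subgroup K"
  shows "gabor_support m (indicator K) (indicator K) = K \<times> fixed_dual K"
proof -
  have "(\<exists>u\<in>fst (class_rep c). gabor m (indicator K) (indicator K) x (class_rep c) u \<noteq> 0)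
      \<longleftrightarrow> x \<in> K \<and> has_fixed_vector K (class_rep c)" if "c \<in> unitary_dual" for x c
  proof -
    obtain H \<pi> where c: "class_rep c = (H, \<pi>)" by (cases "class_rep c")
    have irr: "irreducible_rep (H, \<pi>)" using irreducible_class_rep[OF that] c by simp
    then have rep: "unitary_rep (H, \<pi>)" by (simp add: irreducible_rep_def)
    have fin: "finite_dim H" by (rule moore_group_finite_dim[OF moore irr])
    show ?thesis
    proof (cases "x \<in> K")
      case True
      then have "(\<lambda>y. indicator K y * cnj (indicator K (- x + y))) = (indicator K :: 'g \<Rightarrow> complex)"
        using subgroup_translate_mem_iff[OF K compact_open_subgroupD(5)[OF K True]]
        by (auto simp: indicator_def fun_eq_iff)
      then show ?thesis
        using True fourier_indicator_nonzero_iff[OF m K rep fin] by (simp add: gabor_eq_fourier c)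
    next
      case False
      have "y \<notin> K \<or> - x + y \<notin> K" for y
      proof (rule ccontr)
        assume "\<not> ?thesis"
        then have "y + - (- x + y) \<in> K" using compact_open_subgroupD(4,5)[OF K] by blast
        then show False using False by (simp add: minus_add)
      qed
      then have "(\<lambda>y. indicator K y * cnj (indicator K (- x + y))) = (\<lambda>_. 0 :: complex)"
        by (fastforce simp: indicator_def fun_eq_iff)
      then show ?thesis
        using False fourier_zero[OF m rep fin] by (simp add: gabor_eq_fourier c)
    qed
  qed
  then show ?thesis by (auto simp: gabor_support_def fixed_dual_def)
qed

text \<open>For sigma-finite \<open>N\<close> this is an equality.  The inequality holds in general because the product
measure is by definition either given by the iterated integral or zero; this
covers Plancherel measures, whose definition does not include sigma-finiteness.\<close>

lemma emeasure_pair_measure_Times_le: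
  assumes "A \<in> sets M" "B \<in> sets N"
  shows "emeasure (M \<Otimes>\<^sub>M N) (A \<times> B) \<le> emeasure M A * emeasure N B"
proof -
  have "emeasure (M \<Otimes>\<^sub>M N) (A \<times> B)
      \<le> (\<integral>\<^sup>+x. (\<integral>\<^sup>+y. indicator (A \<times> B) (x, y) \<partial>N) \<partial>M)"
    unfolding pair_measure_def emeasure_measure_of_conv by simp
  also have "\<dots> = (\<integral>\<^sup>+x. emeasure N B * indicator A x \<partial>M)"
    using assms(2) by (simp add: indicator_times nn_integral_cmult mult.commute)
  also have "\<dots> = emeasure M A * emeasure N B"
    using assms(1) by (subst nn_integral_cmult_indicator) (simp_all add: mult.commute)
  finally show ?thesis .
qed

lemma indicator_in_L2:
  assumes "haar_measure m" "compact_open_subgroup K"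
  shows "indicator K \<in> L1 m" "indicator K \<in> L2 m"
    "(\<integral>\<^sup>+x. ennreal ((cmod (indicator K x))\<^sup>2) \<partial>m) = ennreal (measure m K)"
proof -
  note Km = compact_open_subgroup_measure[OF assms]
  show "indicator K \<in> L1 m" using indicator_integrable[OF assms] by (simp add: L1_def)
  have sq: "(cmod (indicator K x))\<^sup>2 = indicator K x" for x by (simp add: indicator_def)
  have "integrable m (indicator K :: _ \<Rightarrow> real)"
    using Km by (simp add: integrable_indicator_iff)
  then show "indicator K \<in> L2 m"
    using indicator_integrable[OF assms] by (simp add: L2_def sq borel_measurable_integrable)
  show "(\<integral>\<^sup>+x. ennreal ((cmod (indicator K x))\<^sup>2) \<partial>m) = ennreal (measure m K)"
    using Km by (simp add: sq ennreal_indicator)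
qed

lemma plancherel_measure_space: "plancherel_measure m \<mu> \<Longrightarrow> space \<mu> = unitary_dual"
  using sets_eq_imp_space_eq[of \<mu> dual_borel]
  by (simp add: plancherel_measure_def dual_borel_def space_measure_of_conv)

lemma plancherel_measureD:
  assumes "plancherel_measure m \<mu>" "f \<in> L1 m" "f \<in> L2 m"
  shows "(\<integral>\<^sup>+c. hs_norm_sq (fst (class_rep c)) (fourier m f (class_rep c)) \<partial>\<mu>)
      = (\<integral>\<^sup>+x. ennreal ((cmod (f x))\<^sup>2) \<partial>m)"
  using assms by (simp add: plancherel_measure_def)

definition nontrivial_dual :: "'g::topological_group_add set \<Rightarrow> 'g \<Rightarrow> 'g rep set set" where
  "nontrivial_dual K x =
     {c \<in> unitary_dual. acts_trivially K (class_rep c) \<and> \<not> acts_trivially {x} (class_rep c)}"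

lemma
  fixes m :: "'g::{topological_group_add, t2_space, second_countable_topology} measure"
  assumes moore: "moore_group TYPE('g)" and m: "haar_measure m" and \<mu>: "plancherel_measure m \<mu>"
    and K: "compact_open_subgroup K"
  shows sets_fixed_dual: "fixed_dual K \<in> sets \<mu>"
    and sets_nontrivial_dual: "nontrivial_dual K x \<in> sets \<mu>"
proof -
  have s: "sets \<mu> = sets dual_borel" using \<mu> by (simp add: plancherel_measure_def)
  show "fixed_dual K \<in> sets \<mu>"
    unfolding s fixed_dual_def
    by (rule dual_borel_Collect[OF rep_equiv_has_fixed_vector
          sets_has_fixed_vector[OF m K moore_group_finite_dim[OF moore]]])
  show "nontrivial_dual K x \<in> sets \<mu>"
    unfolding s nontrivial_dual_def
    by (rule dual_borel_Collect[OF _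
          sets_acts_trivially[OF compact_open_subgroupD(2)[OF K] moore_group_finite_dim[OF moore]]])
      (simp add: rep_equiv_acts_trivially)
qed

lemma weak_QUP_imp_fixed_dual_ge:
  fixes m :: "'g::{topological_group_add, t2_space, second_countable_topology} measure"
  assumes moore: "moore_group TYPE('g)" and m: "haar_measure m" and \<mu>: "plancherel_measure m \<mu>"
    and qup: "weak_QUP_gabor m \<mu>" and K: "compact_open_subgroup K"
  shows "1 \<le> ennreal (measure m K) * emeasure \<mu> (fixed_dual K)"
proof -
  note Km = compact_open_subgroup_measure[OF m K]
  have nz: "\<not> (AE x in m. (indicator K x :: complex) = 0)"
  proof
    assume "AE x in m. (indicator K x :: complex) = 0"
    then have "AE x in m. x \<notin> K" by (simp add: indicator_eq_0_iff)
    then have "emeasure m K = 0"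
      using Km(1) by (subst (asm) AE_iff_measurable[of K]) (auto simp: haar_measure_space[OF m])
    then show False using Km(2,3) by simp
  qed
  have "window m (indicator K)" using nz indicator_in_L2[OF m K] by (simp add: window_def)
  moreover have "gabor_support m (indicator K) (indicator K) \<in> sets (m \<Otimes>\<^sub>M \<mu>)"
    unfolding gabor_support_indicator[OF moore m K]
    using Km(1) sets_fixed_dual[OF moore m \<mu> K] by (rule pair_measureI)
  ultimately have "\<not> emeasure (m \<Otimes>\<^sub>M \<mu>) (gabor_support m (indicator K) (indicator K)) < 1"
    using qup nz indicator_in_L2[OF m K] unfolding weak_QUP_gabor_def by blast
  then have "1 \<le> emeasure (m \<Otimes>\<^sub>M \<mu>) (K \<times> fixed_dual K)"
    by (simp add: gabor_support_indicator[OF moore m K] not_less)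
  also have "\<dots> \<le> emeasure m K * emeasure \<mu> (fixed_dual K)"
    using Km(1) sets_fixed_dual[OF moore m \<mu> K] by (rule emeasure_pair_measure_Times_le)
  finally show ?thesis by (simp add: Km(2))
qed

text \<open>With \<open>S = fixed_dual K\<close> and \<open>A\<close> the set in question, the Plancherel formula for \<open>1\<^sub>K\<close> gives
\<open>m(K) \<ge> m(K)\<^sup>2 (\<mu>(S) + \<mu>(A))\<close>, since representations in \<open>A \<subseteq> S\<close> contribute twice.  As
\<open>m(K) \<mu>(S) \<ge> 1\<close>, the first summand already exhausts the left-hand side.\<close>

lemma weak_QUP_imp_nontrivial_dual_null:
  fixes m :: "'g::{topological_group_add, t2_space, second_countable_topology} measure"
  assumes moore: "moore_group TYPE('g)" and m: "haar_measure m" and \<mu>: "plancherel_measure m \<mu>"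
    and qup: "weak_QUP_gabor m \<mu>" and K: "compact_open_subgroup K"
  shows "nontrivial_dual K ((a + b) + - (b + a)) \<in> null_sets \<mu>"
proof -
  let ?A = "nontrivial_dual K ((a + b) + - (b + a))" and ?S = "fixed_dual K" and ?M = "measure m K"
  note Km = compact_open_subgroup_measure[OF m K]
  note SA = sets_fixed_dual[OF moore m \<mu> K] sets_nontrivial_dual[OF moore m \<mu> K]
  have low: "ennreal (?M\<^sup>2) * (indicator ?S c + indicator ?A c)
      \<le> hs_norm_sq (fst (class_rep c)) (fourier m (indicator K) (class_rep c))"
    if "c \<in> space \<mu>" for c
  proof -
    have cd: "c \<in> unitary_dual" using that plancherel_measure_space[OF \<mu>] by simp
    obtain H \<pi> where c: "class_rep c = (H, \<pi>)" by (cases "class_rep c")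
    have irr: "irreducible_rep (H, \<pi>)" using irreducible_class_rep[OF cd] c by simp
    then have rep: "unitary_rep (H, \<pi>)" by (simp add: irreducible_rep_def)
    have fin: "finite_dim H" by (rule moore_group_finite_dim[OF moore irr])
    consider "c \<in> ?A" | "c \<notin> ?A" "c \<in> ?S" | "c \<notin> ?A" "c \<notin> ?S" by blast
    then show ?thesis
    proof cases
      case 1
      then have "2 * ennreal (?M\<^sup>2) \<le> hs_norm_sq H (fourier m (indicator K) (H, \<pi>))"
        using c by (intro hs_norm_fourier_indicator_ge_two[OF m K irr fin]) (auto simp: nontrivial_dual_def)
      moreover have "ennreal (?M\<^sup>2) * (indicator ?S c + indicator ?A c) \<le> 2 * ennreal (?M\<^sup>2)"
        by (subst mult.commute, rule mult_right_mono) (auto simp: indicator_def)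
      ultimately show ?thesis using c by simp
    next
      case 2
      then show ?thesis
        using hs_norm_fourier_indicator_ge[OF m K rep fin] c by (simp add: fixed_dual_def)
    qed simp
  qed
  have "ennreal ?M * (ennreal ?M * emeasure \<mu> ?S) + ennreal (?M\<^sup>2) * emeasure \<mu> ?A
      = (\<integral>\<^sup>+c. ennreal (?M\<^sup>2) * (indicator ?S c + indicator ?A c) \<partial>\<mu>)"
    using SA by (simp add: nn_integral_cmult nn_integral_add distrib_left power2_eq_square ennreal_mult mult.assoc)
  also have "\<dots> \<le> (\<integral>\<^sup>+c. hs_norm_sq (fst (class_rep c)) (fourier m (indicator K) (class_rep c)) \<partial>\<mu>)"
    by (rule nn_integral_mono) (rule low)
  also have "\<dots> = ennreal ?M"
    unfolding plancherel_measureD[OF \<mu> indicator_in_L2(1,2)[OF m K]]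
    by (rule indicator_in_L2(3)[OF m K])
  finally have upper: "ennreal ?M * (ennreal ?M * emeasure \<mu> ?S) + ennreal (?M\<^sup>2) * emeasure \<mu> ?A \<le> ennreal ?M" .
  have "ennreal ?M * 1 \<le> ennreal ?M * (ennreal ?M * emeasure \<mu> ?S)"
    by (rule mult_left_mono[OF weak_QUP_imp_fixed_dual_ge[OF moore m \<mu> qup K]]) simp
  then have "ennreal ?M + ennreal (?M\<^sup>2) * emeasure \<mu> ?A
      \<le> ennreal ?M * (ennreal ?M * emeasure \<mu> ?S) + ennreal (?M\<^sup>2) * emeasure \<mu> ?A"
    by (simp add: add_right_mono)
  also note upper
  finally have "ennreal ?M + ennreal (?M\<^sup>2) * emeasure \<mu> ?A \<le> ennreal ?M + 0" by simp
  then have "ennreal (?M\<^sup>2) * emeasure \<mu> ?A = 0"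
    by (simp add: ennreal_add_left_cancel_le)
  then have "emeasure \<mu> ?A = 0" using Km(3) by simp
  then show ?thesis using SA by (simp add: null_sets_def)
qed


section \<open>Commutators lie in the identity component\<close>

text \<open>Translating by \<open>x\<close> turns the integral over the coset \<open>x + K\<close> into one over \<open>K\<close>, with \<open>\<pi>(x)\<close> moved
to the other argument of the inner product.\<close>

lemma translate_difference_coefficient:
  fixes m :: "'g::{topological_group_add, t2_space, second_countable_topology} measure"
  assumes m: "haar_measure m" and K: "compact_open_subgroup K" and rep: "unitary_rep (H, \<pi>)"
    and fin: "finite_dim H" and u: "u \<in> H" and v: "v \<in> H"
    and f: "integrable m (\<lambda>y. indicator K (- x + y) :: complex)"
  shows "cinner (fourier m (\<lambda>y. indicator K y - indicator K (- x + y)) (H, \<pi>) u) v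
      = average_coeff m K (H, \<pi>) u v - average_coeff m K (H, \<pi>) (\<pi> (- x) u) v"
proof -
  note fK = indicator_integrable[OF m K]
  have "(\<lambda>y. indicator K (- x + y) * cinner u (\<pi> y v)) \<in> borel_measurable borel"
    using borel_measurable_integrable[OF coefficient_integrable[OF m rep v f, of u]]
    by (simp add: measurable_cong_sets[OF haar_measure_sets[OF m] refl])
  from haar_integral_translate[OF m this, of x]
  have "(LINT y|m. indicator K (- x + y) * cinner u (\<pi> y v)) = (LINT y|m. indicator K y * cinner u (\<pi> (x + y) v))"
    by (simp add: add.assoc[symmetric])
  also have "\<dots> = average_coeff m K (H, \<pi>) (\<pi> (- x) u) v"
    using cinner_rep_left[OF rep u unitary_repD(4)[OF rep v], of "- x"]
    by (simp add: average_coeff_def unitary_repD(8)[OF rep v])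
  finally show ?thesis
    using fourier_coefficient(2)[OF m rep fin Bochner_Integration.integrable_diff[OF fK f] u v]
      coefficient_integrable[OF m rep v fK, of u] coefficient_integrable[OF m rep v f, of u]
    by (simp add: average_coeff_def left_diff_distrib)
qed

text \<open>Otherwise the difference of the indicators of \<open>K\<close> and \<open>x + K\<close>, for a suitable \<open>K\<close> not containing the
commutator \<open>x\<close>, would have a Fourier transform that vanishes almost everywhere.\<close>

lemma commutator_mem_identity_component:
  fixes m :: "'g::{topological_group_add, t2_space, second_countable_topology} measure"
  assumes moore: "moore_group TYPE('g)" and cpt: "compact (identity_component :: 'g set)"
    and m: "haar_measure m" and \<mu>: "plancherel_measure m \<mu>" and qup: "weak_QUP_gabor m \<mu>"
  shows "(a + b) + - (b + a) \<in> (identity_component :: 'g set)"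
proof (rule ccontr)
  define x where "x = (a + b) + - (b + a)"
  assume "(a + b) + - (b + a) \<notin> (identity_component :: 'g set)"
  then have "identity_component \<subseteq> - {x}" by (auto simp: x_def)
  have lc: "locally_compact_space (euclidean :: 'g topology)"
    using moore by (simp add: moore_group_def)
  obtain K :: "'g set" where K: "compact_open_subgroup K" "x \<notin> K"
    using compact_open_subgroup_in_nbhd[OF lc cpt _ \<open>identity_component \<subseteq> - {x}\<close>] by auto
  note Km = compact_open_subgroup_measure[OF m K(1)]
  define f :: "'g \<Rightarrow> complex" where "f = (\<lambda>y. indicator K y - indicator K (- x + y))"
  have tr: "integrable m (\<lambda>y. indicator K (- x + y) :: complex)"
  proof (rule integrableI_bounded_set[where A = "(+) x ` K" and B = 1])
    have "open ((+) x ` K)"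
      unfolding image_add_eq_vimage
      by (intro open_vimage compact_open_subgroupD(2)[OF K(1)] continuous_intros)
    then show A: "(+) x ` K \<in> sets m" by (simp add: haar_measure_sets[OF m])
    have eq: "(\<lambda>y. indicator K (- x + y)) = (indicator ((+) x ` K) :: 'g \<Rightarrow> complex)"
      by (auto simp: image_add_eq_vimage indicator_def fun_eq_iff)
    show "(\<lambda>y. indicator K (- x + y) :: complex) \<in> borel_measurable m"
      unfolding eq using A by measurable
    have "emeasure m ((+) x ` K) = emeasure m K"
      using m Km(1) haar_measure_sets[OF m] by (simp add: haar_measure_def)
    then show "emeasure m ((+) x ` K) < \<infinity>" using Km(2) by simp
  qed (auto simp: image_add_eq_vimage indicator_def)
  have fint: "integrable m f"
    unfolding f_def using indicator_integrable[OF m K(1)] tr by (rule Bochner_Integration.integrable_diff)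
  have "integrable m (\<lambda>y. (cmod (f y))\<^sup>2)"
    by (rule Bochner_Integration.integrable_bound[OF fint])
      (use fint in \<open>auto simp: f_def indicator_def\<close>)
  then have f: "f \<in> L1 m" "f \<in> L2 m"
    using fint by (simp_all add: L1_def L2_def borel_measurable_integrable)
  \<comment> \<open>The subgroup on which \<open>\<pi>\<close> becomes trivial depends on \<open>\<pi>\<close>, so all of them are removed at once.\<close>
  define N where "N = (\<Union>K'\<in>{K'. compact_open_subgroup K'}. nontrivial_dual K' x)"
  have "countable {K' :: 'g set. compact_open_subgroup K'}"
    by (rule countable_subset[OF _ countable_compact_open_sets]) (auto dest: compact_open_subgroupD)
  then have N: "N \<in> null_sets \<mu>"
    unfolding N_def x_def
    using weak_QUP_imp_nontrivial_dual_null[OF moore m \<mu> qup] by (intro null_sets_UN') auto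
  have zero: "hs_norm_sq (fst (class_rep c)) (fourier m f (class_rep c)) = 0"
    if cd: "c \<in> unitary_dual" and "c \<notin> N" for c
  proof -
    obtain H \<pi> where c: "class_rep c = (H, \<pi>)" by (cases "class_rep c")
    have irr: "irreducible_rep (H, \<pi>)" using irreducible_class_rep[OF cd] c by simp
    then have rep: "unitary_rep (H, \<pi>)" by (simp add: irreducible_rep_def)
    have fin: "finite_dim H" by (rule moore_group_finite_dim[OF moore irr])
    \<comment> \<open>Either both averages vanish for lack of fixed vectors, or \<open>\<pi>\<close> avoids the null set and \<open>\<pi>(x) = 1\<close>.\<close>
    have coeff0: "average_coeff m K (H, \<pi>) u v = average_coeff m K (H, \<pi>) (\<pi> (- x) u) v"
      if u: "u \<in> H" and v: "v \<in> H" for u v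
    proof (cases "has_fixed_vector K (H, \<pi>)")
      case False
      then show ?thesis
        using average_coeff_nonzero_imp_fixed_vector[OF m K(1) rep fin _ v] u unitary_repD(4)[OF rep u]
        by metis
    next
      case True
      then have "has_fixed_vector identity_component (H, \<pi>)"
        using identity_component_subset_subgroup[OF K(1)]
        by (auto simp: has_fixed_vector_def fixes_vector_def)
      then have "acts_trivially identity_component (H, \<pi>)"
      proof (rule irreducible_fixed_vector_imp_acts_trivially[OF irr, rotated])
        show "- z + y + z \<in> identity_component" if "y \<in> identity_component" for y z :: 'g
          using identity_component_conj[OF that, of "- z"] by simp
      qed
      then obtain K' where "compact_open_subgroup K'" "acts_trivially K' (H, \<pi>)"
        using acts_trivially_on_nbhd[OF m lc cpt rep fin] by blast
      then have "acts_trivially {x} (H, \<pi>)"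
        using \<open>c \<notin> N\<close> cd c by (auto simp: N_def nontrivial_dual_def)
      then have "\<pi> x u = u" using u by (simp add: acts_trivially_def fixes_vector_def)
      then have "\<pi> (- x) u = u" using unitary_rep_inverse(2)[OF rep u, of x] by simp
      then show ?thesis by simp
    qed
    have T0: "fourier m f (H, \<pi>) u = 0" if u: "u \<in> H" for u
    proof (rule cinner_ext[OF _ closed_csubspace_zero_mem[OF unitary_repD(1)[OF rep]] unitary_repD(2)[OF rep]])
      show "fourier m f (H, \<pi>) u \<in> H" by (rule fourier_coefficient(1)[OF m rep fin fint u])
      show "cinner (fourier m f (H, \<pi>) u) v = cinner 0 v" if v: "v \<in> H" for v
        using translate_difference_coefficient[OF m K(1) rep fin u v tr] coeff0[OF u v]
        by (simp add: f_def)
    qed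
    obtain B where B: "finite_onb H B"
      "\<And>T. hs_norm_sq H T = (\<Sum>e\<in>B. ennreal ((norm (T e))\<^sup>2))"
      using hs_norm_sq_onb[OF fin unitary_repD(1)[OF rep]] by metis
    then have "fourier m f (H, \<pi>) e = 0" if "e \<in> B" for e
      using T0 that by (auto simp: finite_onb_def)
    then show ?thesis by (simp add: c B(2))
  qed
  have "AE c in \<mu>. hs_norm_sq (fst (class_rep c)) (fourier m f (class_rep c)) = 0"
    using AE_not_in[OF N] AE_space
    by eventually_elim (use zero plancherel_measure_space[OF \<mu>] in auto)
  then have "(\<integral>\<^sup>+c. hs_norm_sq (fst (class_rep c)) (fourier m f (class_rep c)) \<partial>\<mu>) = (\<integral>\<^sup>+c. 0 \<partial>\<mu>)"
    by (rule nn_integral_cong_AE)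
  then have "(\<integral>\<^sup>+y. ennreal ((cmod (f y))\<^sup>2) \<partial>m) = 0"
    by (simp add: plancherel_measureD[OF \<mu> f])
  moreover have "(\<integral>\<^sup>+y. indicator K y \<partial>m) \<le> (\<integral>\<^sup>+y. ennreal ((cmod (f y))\<^sup>2) \<partial>m)"
  proof (rule nn_integral_mono)
    fix y
    have "- x + y \<notin> K" if "y \<in> K"
    proof
      assume "- x + y \<in> K"
      then have "y + - (- x + y) \<in> K" using that compact_open_subgroupD(4,5)[OF K(1)] by blast
      then show False using K(2) by (simp add: minus_add)
    qed
    then show "indicator K y \<le> ennreal ((cmod (f y))\<^sup>2)" by (auto simp: f_def indicator_def)
  qed
  ultimately have "emeasure m K = 0" using Km(1) by simp
  then show False using Km(2,3) by simp
qed

theorem proposition4p3: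
  fixes m :: "'g::{topological_group_add, t2_space, second_countable_topology} measure"
    and \<mu> :: "'g rep set measure"
  assumes "moore_group TYPE('g)"
    and "compact (identity_component :: 'g set)"
    and "haar_measure m"
    and "plancherel_measure m \<mu>"
    and "weak_QUP_gabor m \<mu>"
  shows "comm_group (group_of TYPE('g) Mod (identity_component :: 'g set))"
  by (rule comm_quotient_by_identity_component)
    (rule commutator_mem_identity_component[OF assms])

end
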